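(* Let $d\ge1$, $\mathsf{g}=\mathcal{N}(0,I_d)$, and let $\mu$ be a centred Borel probability measure on $\mathbb{R}^d$ which is absolutely continuous with respect to Lebesgue measure, has finite covariance matrix $\Sigma$, and has (finite) Poincaré constant $C_P=C_P(\mu)$. Then $$\mathrm{KL}(\mu*\mathsf{g}\,\|\,\mathsf{g})\le\frac{\log 2}{2}\,C_P\,\mathrm{tr}(\Sigma).$$
   Context: The Poincaré constant $C_P(\mu)$ of a measure $\mu$ is the smallest $C\in[0,\infty]$ such that $\mathrm{Var}_\mu(f)\leq C\int\|\nabla f\|^2\,d\mu$ for all smooth $f\in L^2(\mu)$. "Centred" means $\int x\,\mu(dx)=0$. $*$ denotes convolution of measures, and $\mathrm{KL}(\rho\|\mathsf{g}):=\int\log\frac{d\rho}{d\mathsf{g}}\,d\rho$ is the relative entropy (Kullback–Leibler divergence). *)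

theory Defs
  imports "HOL-Probability.Probability"
begin

definition std_gaussian :: "(real ^ 'n) measure" where
  "std_gaussian = density lborel (\<lambda>x. ennreal (\<Prod>i\<in>UNIV. std_normal_density (x $ i)))"

definition centred :: "(real ^ 'n) measure \<Rightarrow> bool" where
  "centred \<mu> \<longleftrightarrow> integrable \<mu> (\<lambda>x. x) \<and> (\<integral>x. x \<partial>\<mu>) = 0"

definition mean :: "(real ^ 'n) measure \<Rightarrow> real ^ 'n" where
  "mean \<mu> = (\<integral>x. x \<partial>\<mu>)"

definition covariance_matrix :: "(real ^ 'n) measure \<Rightarrow> real ^ 'n ^ 'n" where
  "covariance_matrix \<mu> =
     (\<chi> i j. \<integral>x. (x $ i - mean \<mu> $ i) * (x $ j - mean \<mu> $ j) \<partial>\<mu>)"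

definition finite_covariance :: "(real ^ 'n) measure \<Rightarrow> bool" where
  "finite_covariance \<mu> \<longleftrightarrow> integrable \<mu> (\<lambda>x. x) \<and>
     (\<forall>i j. integrable \<mu> (\<lambda>x. (x $ i - mean \<mu> $ i) * (x $ j - mean \<mu> $ j)))"

primrec times_cont_differentiable ::
    "nat \<Rightarrow> ('a::real_normed_vector \<Rightarrow> 'b::real_normed_vector) \<Rightarrow> bool" where
  "times_cont_differentiable 0 f \<longleftrightarrow> continuous_on UNIV f"
| "times_cont_differentiable (Suc k) f \<longleftrightarrow> (\<forall>x. f differentiable (at x)) \<and>
     (\<forall>v. times_cont_differentiable k (\<lambda>x. frechet_derivative f (at x) v))"

definition smooth :: "('a::real_normed_vector \<Rightarrow> 'b::real_normed_vector) \<Rightarrow> bool" where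
  "smooth f \<longleftrightarrow> (\<forall>k. times_cont_differentiable k f)"

definition gradient :: "(real ^ 'n \<Rightarrow> real) \<Rightarrow> real ^ 'n \<Rightarrow> real ^ 'n" where
  "gradient f x = (\<chi> i. frechet_derivative f (at x) (axis i 1))"

definition square_integrable :: "'a measure \<Rightarrow> ('a \<Rightarrow> real) \<Rightarrow> bool" where
  "square_integrable \<mu> f \<longleftrightarrow> f \<in> borel_measurable \<mu> \<and> integrable \<mu> (\<lambda>x. (f x)\<^sup>2)"

definition variance_of :: "'a measure \<Rightarrow> ('a \<Rightarrow> real) \<Rightarrow> real" where
  "variance_of \<mu> f = (\<integral>x. (f x - (\<integral>y. f y \<partial>\<mu>))\<^sup>2 \<partial>\<mu>)"

(* The Dirichlet energy may be infinite, so it is a nonnegative integral. If no finite C is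
   admissible the infimum is \<infinity>, also when C = \<infinity> itself is excluded by the
   convention \<infinity> * 0 = 0 of ennreal. *)
definition poincare_constant :: "(real ^ 'n) measure \<Rightarrow> ennreal" where
  "poincare_constant \<mu> =
     Inf {C. \<forall>f. smooth f \<and> square_integrable \<mu> f \<longrightarrow>
       ennreal (variance_of \<mu> f) \<le> C * (\<integral>\<^sup>+x. ennreal ((norm (gradient f x))\<^sup>2) \<partial>\<mu>)}"

(* The relative entropy KL(\<rho> || \<nu>) in nats with values in [0, \<infinity>], for probability
   measures. The library's KL_divergence takes the reference measure first and, being a
   Bochner integral, is 0 when the log-density is not integrable; for \<rho> << \<nu> the negative
   part of the log-density is always \<rho>-integrable, so the value is \<infinity> in that case. *)
definition relative_entropy :: "'a measure \<Rightarrow> 'a measure \<Rightarrow> ereal" where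
  "relative_entropy \<rho> \<nu> =
     (if absolutely_continuous \<nu> \<rho> \<and> integrable \<rho> (entropy_density (exp 1) \<nu> \<rho>)
      then ereal (KL_divergence (exp 1) \<nu> \<rho>) else \<infinity>)"

end

theory Submission
  imports Defs
begin

text \<open>
  Let \<open>X\<close> have law \<open>\<mu>\<close>, let \<open>G\<close> be an independent standard Gaussian, put \<open>Y = a X + G\<close> and let
  \<open>m\<close> be the posterior mean \<open>E[X | Y]\<close>. Differentiating the logarithm of the density of \<open>Y\<close> with respect
  to \<open>G\<close> along the path \<open>a \<mapsto> a X + G\<close> and using the tower property (no integration by parts is
  needed) gives the I-MMSE type identity \<open>KL = \<integral> a E|m|\<^sup>2 da\<close> over \<open>a\<close> from \<open>0\<close> to \<open>1\<close>.
  By duality \<open>E m\<^sub>i\<^sup>2\<close> is controlled by the covariances of \<open>X\<^sub>i\<close> with \<open>E[\<psi>(Y) | X]\<close>, a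
  smooth function of \<open>X\<close> whose squared gradient is at most \<open>a\<^sup>2 E[\<psi>(Y)\<^sup>2 | X]\<close> by
  Cameron--Martin and Bessel. The Poincare inequality for it yields
  \<open>E|m|\<^sup>2 \<le> C a\<^sup>2 tr \<Sigma>\<close>, hence \<open>KL \<le> C tr \<Sigma> / 4\<close>, and \<open>1/4 \<le> (ln 2)/2\<close>.
\<close>

subsection \<open>Parameter integrals\<close>

text \<open>The path is differentiated with \<open>X\<close> and \<open>G\<close> held fixed: only
  \<open>a\<close> moves, so the log-density at \<open>a X + G\<close> is a function of one real
  variable, and no evolution equation for the densities is needed. Integration by parts would enter
  through a term pairing \<open>m\<close> with the noise \<open>G\<close> alone. It disappears
  because \<open>G\<close> is regrouped into \<open>Y\<close>, and pairings of \<open>m\<close> with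
  a function of \<open>Y\<close> are again covered by conditioning. The obstacle is regularity. The
  Poincare inequality is available only for smooth square-integrable functions, whereas duality asks
  for the test function \<open>m\<close>, of which only measurability is known beforehand.
  Truncating \<open>m\<close> makes it bounded with bounded support, and writing the conditional
  expectation against a fixed Gaussian puts the variable \<open>x\<close> into an exponential kernel
  alone, so that a merely measurable test function still yields a smooth function of
  \<open>x\<close>. The constant 1/4 is the right one to leading order: for
  \<open>\<mu> = N(0, s I)\<close> with small \<open>s\<close> the entropy is
  \<open>d (s - ln (1 + s)) / 2\<close>, about \<open>d s^2 / 4\<close>, while
  \<open>C tr \<Sigma> = d s^2\<close>.\<close>

text \<open>Dominated convergence applied to the remainder quotients along sequences tending to
  \<open>x0\<close>. The majorant is \<open>2 * B\<close>, one \<open>B\<close> for the increment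
  and one for the linear part. Frechet form serves both the vector argument of the smoothing and the
  real parameter of the path.\<close>

lemma has_derivative_lebesgue_integral:
  fixes F :: "'a::real_normed_vector \<Rightarrow> 'b \<Rightarrow> real"
  assumes "0 < e"
    and int: "\<And>x. x \<in> ball x0 e \<Longrightarrow> integrable M (F x)"
    and der: "\<And>z. z \<in> space M \<Longrightarrow> ((\<lambda>x. F x z) has_derivative F' z) (at x0)"
    and meas: "\<And>h. (\<lambda>z. F' z h) \<in> borel_measurable M"
    and bnd: "\<And>z h. z \<in> space M \<Longrightarrow> \<bar>F' z h\<bar> \<le> B z * norm h"
    and lip: "\<And>x z. x \<in> ball x0 e \<Longrightarrow> z \<in> space M \<Longrightarrow> \<bar>F x z - F x0 z\<bar> \<le> B z * norm (x - x0)"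
    and B: "integrable M B"
  shows "((\<lambda>x. \<integral>z. F x z \<partial>M) has_derivative (\<lambda>h. \<integral>z. F' z h \<partial>M)) (at x0)"
proof -
  have lin: "bounded_linear (F' z)" if "z \<in> space M" for z
    using der[OF that] by (rule has_derivative_bounded_linear)
  have int': "integrable M (\<lambda>z. F' z h)" for h
  proof (rule Bochner_Integration.integrable_bound[of M "\<lambda>z. B z * norm h"])
    show "AE z in M. norm (F' z h) \<le> norm (B z * norm h)"
      by (rule AE_I2) (use bnd[of _ h] in \<open>simp add: order.trans[OF _ abs_ge_self]\<close>)
  qed (use B meas in auto)
  have x0: "x0 \<in> ball x0 e" using \<open>0 < e\<close> by simp
  have "bounded_linear (\<lambda>h. \<integral>z. F' z h \<partial>M)"
  proof (rule bounded_linear_intro)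
    fix x y
    have "(\<integral>z. F' z (x + y) \<partial>M) = (\<integral>z. F' z x + F' z y \<partial>M)"
      by (intro Bochner_Integration.integral_cong refl) (use lin in \<open>simp add: bounded_linear.linear linear_add\<close>)
    then show "(\<integral>z. F' z (x + y) \<partial>M) = (\<integral>z. F' z x \<partial>M) + (\<integral>z. F' z y \<partial>M)"
      using int' by simp
  next
    fix r x
    have "(\<integral>z. F' z (r *\<^sub>R x) \<partial>M) = (\<integral>z. r * F' z x \<partial>M)"
      by (intro Bochner_Integration.integral_cong refl) (use lin in \<open>simp add: bounded_linear.linear linear_cmul\<close>)
    then show "(\<integral>z. F' z (r *\<^sub>R x) \<partial>M) = r *\<^sub>R (\<integral>z. F' z x \<partial>M)"
      by simp
  next
    fix x
    have "norm (\<integral>z. F' z x \<partial>M) \<le> (\<integral>z. B z * norm x \<partial>M)"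
      by (rule order_trans[OF integral_norm_bound], rule integral_mono) (use int' B bnd in auto)
    then show "norm (\<integral>z. F' z x \<partial>M) \<le> norm x * (\<integral>z. B z \<partial>M)"
      using B by (simp add: mult.commute)
  qed
  moreover have "((\<lambda>y. norm ((\<integral>z. F y z \<partial>M) - (\<integral>z. F x0 z \<partial>M) - (\<integral>z. F' z (y - x0) \<partial>M)) / norm (y - x0))
      \<longlongrightarrow> 0) (at x0 within ball x0 e)"
    unfolding tendsto_at_iff_sequentially comp_def
  proof (intro allI impI)
    fix X :: "nat \<Rightarrow> 'a"
    assume X: "\<forall>i. X i \<in> ball x0 e - {x0}" and lim: "X \<longlonglongrightarrow> x0"
    let ?s = "\<lambda>i z. (F (X i) z - F x0 z - F' z (X i - x0)) / norm (X i - x0)"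
    have Xb: "X i \<in> ball x0 e" "norm (X i - x0) > 0" for i using X by auto
    have "(\<lambda>i. \<integral>z. ?s i z \<partial>M) \<longlonglongrightarrow> (\<integral>z. 0 \<partial>M)"
    proof (rule integral_dominated_convergence)
      show "integrable M (\<lambda>z. 2 * B z)" using B by simp
      show "?s i \<in> borel_measurable M" for i
        using int[OF Xb(1)] int[OF x0] meas by auto
      show "AE z in M. (\<lambda>i. ?s i z) \<longlonglongrightarrow> 0"
      proof (rule AE_I2)
        fix z assume "z \<in> space M"
        from der[OF this] have "((\<lambda>y. norm (F y z - F x0 z - F' z (y - x0)) / norm (y - x0)) \<longlongrightarrow> 0) (at x0)"
          by (simp add: has_derivative_iff_norm)
        then have "(\<lambda>i. norm (F (X i) z - F x0 z - F' z (X i - x0)) / norm (X i - x0)) \<longlonglongrightarrow> 0"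
          unfolding tendsto_at_iff_sequentially comp_def using X lim by auto
        then have "(\<lambda>i. norm (?s i z)) \<longlonglongrightarrow> 0" by simp
        then show "(\<lambda>i. ?s i z) \<longlonglongrightarrow> 0" by (rule tendsto_norm_zero_cancel)
      qed
      show "AE z in M. norm (?s i z) \<le> 2 * B z" for i
      proof (rule AE_I2)
        fix z assume z: "z \<in> space M"
        have "\<bar>F (X i) z - F x0 z - F' z (X i - x0)\<bar> \<le> 2 * B z * norm (X i - x0)"
          using lip[OF Xb(1) z, of i] bnd[OF z, of "X i - x0"] by linarith
        then show "norm (?s i z) \<le> 2 * B z"
          using Xb(2)[of i] by (simp add: divide_simps)
      qed
    qed simp
    moreover have "(\<integral>z. ?s i z \<partial>M) = ((\<integral>z. F (X i) z \<partial>M) - (\<integral>z. F x0 z \<partial>M) - (\<integral>z. F' z (X i - x0) \<partial>M)) / norm (X i - x0)" for i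
      using int[OF Xb(1)] int[OF x0] int' by simp
    ultimately have "(\<lambda>i. ((\<integral>z. F (X i) z \<partial>M) - (\<integral>z. F x0 z \<partial>M) - (\<integral>z. F' z (X i - x0) \<partial>M)) / norm (X i - x0)) \<longlonglongrightarrow> 0"
      by (simp only: Bochner_Integration.integral_zero)
    from tendsto_norm_zero[OF this]
    show "(\<lambda>i. norm ((\<integral>z. F (X i) z \<partial>M) - (\<integral>z. F x0 z \<partial>M) - (\<integral>z. F' z (X i - x0) \<partial>M)) / norm (X i - x0)) \<longlonglongrightarrow> 0"
      by simp
  qed
  moreover have "at x0 within ball x0 e = at x0"
    using x0 by (intro at_within_open) auto
  ultimately show ?thesis
    unfolding has_derivative_iff_norm by simp
qed

section \<open>Products of square-integrable functions\<close>

lemma integrable_mult_of_square_integrable: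
  fixes f g :: "'a \<Rightarrow> real"
  assumes "f \<in> borel_measurable M" "g \<in> borel_measurable M"
    and f: "integrable M (\<lambda>x. (f x)\<^sup>2)" and g: "integrable M (\<lambda>x. (g x)\<^sup>2)"
  shows "integrable M (\<lambda>x. f x * g x)"
proof (rule Bochner_Integration.integrable_bound[of M "\<lambda>x. (f x)\<^sup>2 + (g x)\<^sup>2"])
  have "\<bar>a * b\<bar> \<le> a\<^sup>2 + b\<^sup>2" for a b :: real
  proof -
    have "2 * \<bar>a * b\<bar> \<le> a\<^sup>2 + b\<^sup>2"
      using sum_squares_bound[of "\<bar>a\<bar>" "\<bar>b\<bar>"] by (simp add: abs_mult)
    then show ?thesis using abs_ge_zero[of "a * b"] by linarith
  qed
  then show "AE x in M. norm (f x * g x) \<le> norm ((f x)\<^sup>2 + (g x)\<^sup>2)" by auto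
qed (use assms in auto)

lemma integral_Cauchy_Schwarz:
  fixes f g :: "'a \<Rightarrow> real"
  assumes m: "f \<in> borel_measurable M" "g \<in> borel_measurable M"
    and f: "integrable M (\<lambda>x. (f x)\<^sup>2)" and g: "integrable M (\<lambda>x. (g x)\<^sup>2)"
  shows "(\<integral>x. f x * g x \<partial>M)\<^sup>2 \<le> (\<integral>x. (f x)\<^sup>2 \<partial>M) * (\<integral>x. (g x)\<^sup>2 \<partial>M)"
proof -
  define A B I where "A = (\<integral>x. (f x)\<^sup>2 \<partial>M)" and "B = (\<integral>x. (g x)\<^sup>2 \<partial>M)" and "I = (\<integral>x. f x * g x \<partial>M)"
  note fg = integrable_mult_of_square_integrable[OF assms]
  have B0: "0 \<le> B" unfolding B_def by simp
  show ?thesis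
  proof (cases "B = 0")
    case True
    then have "AE x in M. g x = 0"
      using integral_nonneg_eq_0_iff_AE[OF g] by (simp add: B_def)
    then have "AE x in M. f x * g x = 0" by eventually_elim simp
    then have "I = 0" unfolding I_def by (rule integral_eq_zero_AE)
    then show ?thesis using True by (simp add: A_def B_def I_def)
  next
    case False
    \<comment> \<open>Up to the factor \<open>B\<close> this is the residual of \<open>f\<close>
      after projection onto \<open>g\<close>; clearing the denominator keeps the expansion
      polynomial.\<close>
    have "0 \<le> (\<integral>x. (B * f x - I * g x)\<^sup>2 \<partial>M)" by simp
    also have "\<dots> = (\<integral>x. B\<^sup>2 * (f x)\<^sup>2 - 2 * B * I * (f x * g x) + I\<^sup>2 * (g x)\<^sup>2 \<partial>M)"
      by (intro Bochner_Integration.integral_cong refl) (simp add: power2_eq_square algebra_simps)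
    also have "\<dots> = B\<^sup>2 * A - 2 * B * I * I + I\<^sup>2 * B"
      using f g fg by (simp add: A_def B_def I_def)
    also have "\<dots> = B * (A * B - I\<^sup>2)" by (simp add: power2_eq_square algebra_simps)
    finally have "0 \<le> A * B - I\<^sup>2" using B0 False by (simp add: zero_le_mult_iff)
    then show ?thesis by (simp add: A_def B_def I_def)
  qed
qed

subsection \<open>The standard Gaussian measure\<close>

lemma borel_measurable_nth [measurable (raw)]:
  fixes f :: "'a \<Rightarrow> real ^ 'n"
  assumes "f \<in> borel_measurable M"
  shows "(\<lambda>x. f x $ i) \<in> borel_measurable M"
  using borel_measurable_inner[OF assms, of "\<lambda>_. axis i 1"] by (simp add: inner_axis)

lemma sets_std_gaussian [simp, measurable_cong]: "sets std_gaussian = sets borel"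
  by (simp add: std_gaussian_def)

lemma space_std_gaussian [simp]: "space std_gaussian = UNIV"
  by (simp add: std_gaussian_def)

lemma prod_std_normal_density:
  fixes x :: "real ^ 'n"
  shows "(\<Prod>i\<in>UNIV. std_normal_density (x $ i)) = (1 / sqrt (2 * pi)) ^ CARD('n) * exp (- (norm x)\<^sup>2 / 2)"
proof -
  have "(norm x)\<^sup>2 = (\<Sum>i\<in>UNIV. (x $ i)\<^sup>2)"
    unfolding power2_norm_eq_inner inner_vec_def by (simp add: power2_eq_square)
  then show ?thesis
    unfolding std_normal_density_def prod.distrib
    by (simp add: exp_sum[symmetric] sum_negf sum_divide_distrib)
qed

lemma std_gaussian_altdef:
  "(std_gaussian :: (real ^ 'n) measure) =
     density lborel (\<lambda>x. ennreal ((1 / sqrt (2 * pi)) ^ CARD('n) * exp (- (norm x)\<^sup>2 / 2)))"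
  unfolding std_gaussian_def prod_std_normal_density ..

lemma prod_Basis_vec:
  fixes F :: "real ^ 'n \<Rightarrow> 'b::comm_monoid_mult"
  shows "(\<Prod>b\<in>Basis. F b) = (\<Prod>i\<in>UNIV. F (axis i 1))"
proof -
  have "inj (\<lambda>i::'n. axis i (1::real))" by (simp add: inj_on_def axis_eq_axis)
  from prod.reindex[OF this, of F] have "prod F (range (\<lambda>i::'n. axis i 1)) = (\<Prod>i\<in>UNIV. F (axis i 1))"
    by (simp add: comp_def)
  moreover have "(Basis :: (real ^ 'n) set) = range (\<lambda>i. axis i 1)"
    by (auto simp: Basis_vec_def)
  ultimately show ?thesis by (simp only:)
qed

lemma prob_space_std_gaussian: "prob_space (std_gaussian :: (real ^ 'n) measure)"
proof
  have 1: "(\<integral>\<^sup>+x. ennreal (std_normal_density x) \<partial>lborel) = 1"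
    using prob_space.emeasure_space_1[OF prob_space_normal_density[of 1 0]] by (simp add: emeasure_density)
  have "emeasure (std_gaussian :: (real ^ 'n) measure) (space std_gaussian)
      = (\<integral>\<^sup>+(x::real ^ 'n). (\<Prod>b\<in>Basis. ennreal (std_normal_density (x \<bullet> b))) \<partial>lborel)"
    unfolding std_gaussian_def
    by (simp add: emeasure_density prod_Basis_vec inner_axis prod_ennreal del: prod_ennreal[symmetric])
  also have "\<dots> = (\<Prod>b\<in>(Basis :: (real ^ 'n) set). (\<integral>\<^sup>+x. ennreal (std_normal_density x) \<partial>lborel))"
    by (rule nn_integral_lborel_prod) auto
  finally show "emeasure (std_gaussian :: (real ^ 'n) measure) (space std_gaussian) = 1"
    by (simp add: 1)
qed

text \<open>Cameron--Martin for a translation: complete the square in the Gaussian exponent and use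
  translation invariance of Lebesgue measure. It will be applied with
  \<open>v = a *\<^sub>R x\<close>.\<close>

lemma distr_std_gaussian_shift:
  fixes v :: "real ^ 'n"
  shows "distr std_gaussian borel (\<lambda>g. v + g) =
    density std_gaussian (\<lambda>y. ennreal (exp (v \<bullet> y - (norm v)\<^sup>2 / 2)))"
proof (rule measure_eqI)
  fix A assume "A \<in> sets (distr std_gaussian borel (\<lambda>g. v + g))"
  then have [measurable]: "A \<in> sets borel" by simp
  let ?c = "(1 / sqrt (2 * pi)) ^ CARD('n)"
  let ?p = "\<lambda>x :: real ^ 'n. ennreal (?c * exp (- (norm x)\<^sup>2 / 2))"
  have sq: "- (norm (y - v))\<^sup>2 / 2 = - (norm y)\<^sup>2 / 2 + (v \<bullet> y - (norm v)\<^sup>2 / 2)" for y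
    by (simp add: power2_norm_eq_inner field_simps inner_commute inner_diff_left inner_diff_right)
  have "emeasure (distr std_gaussian borel (\<lambda>g. v + g)) A = (\<integral>\<^sup>+g. indicator A (v + g) \<partial>std_gaussian)"
    by (simp add: nn_integral_distr flip: nn_integral_indicator)
  also have "\<dots> = (\<integral>\<^sup>+g. ?p (v + g - v) * indicator A (v + g) \<partial>lborel)"
    unfolding std_gaussian_altdef by (subst nn_integral_density) auto
  also have "\<dots> = (\<integral>\<^sup>+y. ?p (y - v) * indicator A y \<partial>distr lborel borel ((+) v))"
    by (subst nn_integral_distr) auto
  also have "\<dots> = (\<integral>\<^sup>+y. ?p y * (ennreal (exp (v \<bullet> y - (norm v)\<^sup>2 / 2)) * indicator A y) \<partial>lborel)"
    unfolding lborel_distr_plus sq exp_add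
    by (intro nn_integral_cong) (simp add: ennreal_mult' mult_ac)
  also have "\<dots> = emeasure (density std_gaussian (\<lambda>y. ennreal (exp (v \<bullet> y - (norm v)\<^sup>2 / 2)))) A"
    unfolding std_gaussian_altdef
    by (subst emeasure_density) (auto simp: nn_integral_density)
  finally show "emeasure (distr std_gaussian borel (\<lambda>g. v + g)) A =
    emeasure (density std_gaussian (\<lambda>y. ennreal (exp (v \<bullet> y - (norm v)\<^sup>2 / 2)))) A" .
qed simp

lemma nn_integral_std_gaussian_shift:
  fixes v :: "real ^ 'n"
  assumes [measurable]: "f \<in> borel_measurable borel"
  shows "(\<integral>\<^sup>+y. ennreal (exp (v \<bullet> y - (norm v)\<^sup>2 / 2)) * f y \<partial>std_gaussian)
    = (\<integral>\<^sup>+g. f (v + g) \<partial>std_gaussian)"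
  using arg_cong[OF distr_std_gaussian_shift, of "\<lambda>M. nn_integral M f" v]
  by (simp add: nn_integral_distr nn_integral_density)

section \<open>Exponential and second moments of the Gaussian\<close>

text \<open>No Gaussian integral is evaluated: the density of the shifted Gaussian has total mass 1,
  and its constant factor is moved to the other side.\<close>

lemma nn_integral_std_gaussian_exp:
  fixes v :: "real ^ 'n"
  shows "(\<integral>\<^sup>+y. ennreal (exp (v \<bullet> y)) \<partial>std_gaussian) = ennreal (exp ((norm v)\<^sup>2 / 2))"
proof -
  interpret prob_space "std_gaussian :: (real ^ 'n) measure" by (rule prob_space_std_gaussian)
  have "(\<integral>\<^sup>+y. ennreal (exp (v \<bullet> y)) \<partial>std_gaussian)
      = (\<integral>\<^sup>+y. ennreal (exp ((norm v)\<^sup>2 / 2)) * (ennreal (exp (v \<bullet> y - (norm v)\<^sup>2 / 2)) * 1) \<partial>std_gaussian)"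
    by (intro nn_integral_cong) (simp flip: ennreal_mult exp_add)
  also have "\<dots> = ennreal (exp ((norm v)\<^sup>2 / 2)) * 1"
    by (subst nn_integral_cmult) (simp_all add: nn_integral_std_gaussian_shift[of "\<lambda>_. 1" v, simplified] emeasure_space_1[simplified])
  finally show ?thesis by simp
qed

text \<open>By the half-angle identity the claim reduces to
  \<open>|s| \<le> |exp (s/2) - exp (- (s/2))|\<close>, a monotonicity statement. It converts
  exponential moments into second moments.\<close>

lemma cosh_ge: "1 + s\<^sup>2 / 2 \<le> (exp s + exp (- s)) / (2::real)"
proof -
  have "(exp (s/2) - exp (- (s/2)))\<^sup>2 = exp s + exp (- s) - 2"
    by (simp add: power2_diff flip: exp_add exp_double)
  moreover have "s\<^sup>2 \<le> (exp (s/2) - exp (- (s/2)))\<^sup>2"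
  proof -
    have pos: "t \<le> exp (t/2) - exp (- (t/2))" if "0 \<le> t" for t :: real
    proof -
      let ?f = "\<lambda>t::real. exp (t/2) - exp (- (t/2)) - t"
      have "?f 0 \<le> ?f t"
      proof (rule DERIV_nonneg_imp_nondecreasing[OF that])
        fix x :: real
        have "(?f has_real_derivative (exp (x/2) + exp (- (x/2))) / 2 - 1) (at x)"
          by (auto intro!: derivative_eq_intros)
        moreover have "0 \<le> (exp (x/2) + exp (- (x/2))) / 2 - 1"
          using exp_ge_add_one_self[of "x/2"] exp_ge_add_one_self[of "- (x/2)"] by argo
        ultimately show "\<exists>y. (?f has_real_derivative y) (at x) \<and> 0 \<le> y" by blast
      qed
      then show ?thesis by simp
    qed
    have "\<bar>s\<bar> \<le> \<bar>exp (s/2) - exp (- (s/2))\<bar>"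
      using pos[of s] pos[of "- s"] by (cases "0 \<le> s") auto
    then show ?thesis by (simp add: abs_le_square_iff)
  qed
  ultimately show ?thesis by simp
qed

lemma
  fixes v :: "real ^ 'n"
  shows integrable_std_gaussian_inner_square: "integrable std_gaussian (\<lambda>g. (v \<bullet> g)\<^sup>2)"
    and integral_std_gaussian_inner_square: "(\<integral>g. (v \<bullet> g)\<^sup>2 \<partial>std_gaussian) \<le> (norm v)\<^sup>2"
proof -
  let ?I = "\<integral>\<^sup>+g. ennreal ((v \<bullet> g)\<^sup>2) \<partial>std_gaussian"
  \<comment> \<open>Taking expectations in \<open>1 + s\<^sup>2 / 2 \<le> cosh s\<close> at \<open>s = t (v \<bullet> g)\<close> and letting \<open>t\<close> tend to \<open>0\<close>
    avoids computing coordinate moments.\<close>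
  interpret prob_space "std_gaussian :: (real ^ 'n) measure" by (rule prob_space_std_gaussian)
  have le: "?I \<le> ennreal (2 * (exp (t\<^sup>2 * (norm v)\<^sup>2 / 2) - 1) / t\<^sup>2)" if "0 < t" for t :: real
  proof -
    have "ennreal (t\<^sup>2) * ?I + 2 = (\<integral>\<^sup>+g. ennreal ((t * (v \<bullet> g))\<^sup>2 + 2) \<partial>std_gaussian)"
      by (simp add: power_mult_distrib ennreal_mult nn_integral_add nn_integral_cmult emeasure_space_1[simplified])
    also have "\<dots> \<le> (\<integral>\<^sup>+g. ennreal (exp ((t *\<^sub>R v) \<bullet> g)) + ennreal (exp ((- (t *\<^sub>R v)) \<bullet> g)) \<partial>std_gaussian)"
    proof (intro nn_integral_mono)
      fix g :: "real ^ 'n"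
      show "ennreal ((t * (v \<bullet> g))\<^sup>2 + 2) \<le> ennreal (exp ((t *\<^sub>R v) \<bullet> g)) + ennreal (exp ((- (t *\<^sub>R v)) \<bullet> g))"
        using cosh_ge[of "t * (v \<bullet> g)"] by (simp flip: ennreal_plus)
    qed
    also have "\<dots> = ennreal (exp (t\<^sup>2 * (norm v)\<^sup>2 / 2)) + ennreal (exp (t\<^sup>2 * (norm v)\<^sup>2 / 2))"
      by (subst nn_integral_add) (simp_all only: nn_integral_std_gaussian_exp, auto simp: power_mult_distrib)
    finally have *: "ennreal (t\<^sup>2) * ?I + 2 \<le> ennreal (2 * exp (t\<^sup>2 * (norm v)\<^sup>2 / 2))"
      by (simp flip: ennreal_plus)
    \<comment> \<open>Finiteness of \<open>?I\<close> comes first, so that the subtraction of 2 can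
      be done over the reals.\<close>
    have "ennreal (t\<^sup>2) * ?I + 2 < \<top>"
      by (rule le_less_trans[OF *]) simp
    then have "?I < \<top>" using that by (auto simp: ennreal_mult_less_top)
    then obtain r where r: "?I = ennreal r" "0 \<le> r" by (cases ?I) auto
    have "ennreal (t\<^sup>2) * ?I + 2 = ennreal (t\<^sup>2 * r + 2)"
      using r by (simp add: ennreal_mult)
    with * have "t\<^sup>2 * r + 2 \<le> 2 * exp (t\<^sup>2 * (norm v)\<^sup>2 / 2)"
      by simp
    then have "r \<le> 2 * (exp (t\<^sup>2 * (norm v)\<^sup>2 / 2) - 1) / t\<^sup>2"
      using that by (simp add: field_simps)
    then show ?thesis using r by (simp add: ennreal_leI)
  qed
  let ?q = "\<lambda>t::real. 2 * (exp (t\<^sup>2 * (norm v)\<^sup>2 / 2) - 1) / t\<^sup>2"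
  \<comment> \<open>In the variable \<open>s = t^2\<close> the bound is twice a difference quotient
    of an exponential at 0, so its limit is twice a derivative.\<close>
  have "((\<lambda>s. (exp (s * ((norm v)\<^sup>2 / 2)) - 1) / s) \<longlongrightarrow> (norm v)\<^sup>2 / 2) (at 0)"
  proof -
    have "((\<lambda>s. exp (s * ((norm v)\<^sup>2 / 2))) has_real_derivative (norm v)\<^sup>2 / 2) (at 0)"
      by (auto intro!: derivative_eq_intros)
    then show ?thesis by (simp add: has_field_derivative_iff)
  qed
  moreover have "filterlim (\<lambda>n. (1 / real (Suc n))\<^sup>2) (at 0) sequentially"
  proof -
    have "(\<lambda>n. (1 / real (Suc n))\<^sup>2) \<longlonglongrightarrow> 0\<^sup>2"
      by (intro tendsto_power LIMSEQ_Suc lim_1_over_n)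
    then show ?thesis by (simp add: filterlim_at)
  qed
  ultimately have "(\<lambda>n. (exp ((1 / real (Suc n))\<^sup>2 * ((norm v)\<^sup>2 / 2)) - 1) / (1 / real (Suc n))\<^sup>2) \<longlonglongrightarrow> (norm v)\<^sup>2 / 2"
    by (rule filterlim_compose)
  from tendsto_mult_left[OF this, of 2]
  have "(\<lambda>n. ?q (1 / real (Suc n))) \<longlonglongrightarrow> (norm v)\<^sup>2"
    by simp
  then have "(\<lambda>n. ennreal (?q (1 / real (Suc n)))) \<longlonglongrightarrow> ennreal ((norm v)\<^sup>2)"
    by (rule tendsto_ennrealI)
  then have nn: "?I \<le> ennreal ((norm v)\<^sup>2)"
    by (rule LIMSEQ_le_const) (use le in auto)
  then show "integrable std_gaussian (\<lambda>g. (v \<bullet> g)\<^sup>2)"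
    by (intro integrableI_bounded) (auto simp: le_less_trans[OF nn])
  then have "?I = ennreal (\<integral>g. (v \<bullet> g)\<^sup>2 \<partial>std_gaussian)"
    by (intro nn_integral_eq_integral) auto
  with nn show "(\<integral>g. (v \<bullet> g)\<^sup>2 \<partial>std_gaussian) \<le> (norm v)\<^sup>2"
    by simp
qed

lemma integrable_std_gaussian_norm_square:
  "integrable std_gaussian (\<lambda>g :: real ^ 'n. (norm g)\<^sup>2)"
proof -
  have "(norm g)\<^sup>2 = (\<Sum>i\<in>UNIV. (axis i 1 \<bullet> g)\<^sup>2)" for g :: "real ^ 'n"
    unfolding power2_norm_eq_inner inner_vec_def[of g g] by (simp add: power2_eq_square inner_axis')
  then show ?thesis
    by (simp only:) (intro Bochner_Integration.integrable_sum integrable_std_gaussian_inner_square)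
qed

lemma abs_inner_le_squares:
  fixes u v :: "'a::real_inner"
  shows "2 * \<bar>u \<bullet> v\<bar> \<le> (norm u)\<^sup>2 + (norm v)\<^sup>2"
  using Cauchy_Schwarz_ineq2[of u v] sum_squares_bound[of "norm u" "norm v"] by linarith

subsection \<open>Gaussian smoothing\<close>

lemma frechet_derivative_eqI: "(f has_derivative D) (at x) \<Longrightarrow> frechet_derivative f (at x) = D"
  by (rule frechet_derivative_at[symmetric])

lemma times_cont_differentiable_SucI:
  assumes "\<And>x. (f has_derivative D x) (at x)"
    and "\<And>v. times_cont_differentiable k (\<lambda>x. D x v)"
  shows "times_cont_differentiable (Suc k) f"
proof -
  have "f differentiable (at x)" for x using assms(1) unfolding differentiable_def by blast
  moreover have "frechet_derivative f (at x) = D x" for x by (rule frechet_derivative_eqI[OF assms(1)])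
  ultimately show ?thesis using assms(2) by simp
qed

text \<open>The product rule leaves one factor undifferentiated, so the induction for products needs
  this loss of one order.\<close>

lemma times_cont_differentiable_Suc_imp:
  "times_cont_differentiable (Suc k) f \<Longrightarrow> times_cont_differentiable k f"
proof (induction k arbitrary: f)
  case 0
  then show ?case
    by (auto intro!: continuous_at_imp_continuous_on differentiable_imp_continuous_within)
next
  case (Suc k)
  from Suc.prems have "\<forall>x. f differentiable (at x)"
    and "times_cont_differentiable (Suc k) (\<lambda>x. frechet_derivative f (at x) v)" for v
    by simp_all
  then show ?case using Suc.IH by simp
qed

lemma times_cont_differentiable_const: "times_cont_differentiable k (\<lambda>_. c)"
proof (induction k arbitrary: c)
  case (Suc k)
  show ?case by (rule times_cont_differentiable_SucI[of _ "\<lambda>_ _. 0"]) (auto intro: Suc)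
qed simp

lemma times_cont_differentiable_add:
  "times_cont_differentiable k f \<Longrightarrow> times_cont_differentiable k g \<Longrightarrow>
    times_cont_differentiable k (\<lambda>x. f x + g x)"
proof (induction k arbitrary: f g)
  case 0
  then show ?case by (simp add: continuous_on_add)
next
  case (Suc k)
  then show ?case
    by (intro times_cont_differentiable_SucI
        [of _ "\<lambda>x v. frechet_derivative f (at x) v + frechet_derivative g (at x) v"] has_derivative_add Suc.IH)
      (simp_all add: frechet_derivative_works[symmetric])
qed

lemma times_cont_differentiable_mult:
  fixes f g :: "'a::real_normed_vector \<Rightarrow> real"
  shows "times_cont_differentiable k f \<Longrightarrow> times_cont_differentiable k g \<Longrightarrow>
    times_cont_differentiable k (\<lambda>x. f x * g x)"
proof (induction k arbitrary: f g)
  case 0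
  then show ?case by (simp add: continuous_on_mult)
next
  case (Suc k)
  have "times_cont_differentiable k f" "times_cont_differentiable k g"
    using Suc.prems by (blast intro: times_cont_differentiable_Suc_imp)+
  with Suc show ?case
    by (intro times_cont_differentiable_SucI
        [of _ "\<lambda>x v. f x * frechet_derivative g (at x) v + frechet_derivative f (at x) v * g x"]
        has_derivative_mult times_cont_differentiable_add Suc.IH)
      (simp_all add: frechet_derivative_works[symmetric])
qed

lemma times_cont_differentiable_inner:
  "times_cont_differentiable k (\<lambda>x::'a::real_inner. c * (x \<bullet> v))"
proof (cases k)
  case 0
  then show ?thesis by (auto intro!: continuous_intros)
next
  case (Suc j)
  then show ?thesis
    by (simp only:, intro times_cont_differentiable_SucI[of _ "\<lambda>x h. c * (h \<bullet> v)"])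
      (auto intro!: derivative_eq_intros times_cont_differentiable_const)
qed

lemma has_derivative_exp_norm_square:
  fixes x :: "'a::real_inner"
  shows "((\<lambda>x. exp (c * (norm x)\<^sup>2)) has_derivative (\<lambda>h. 2 * c * (x \<bullet> h) * exp (c * (norm x)\<^sup>2))) (at x)"
  unfolding power2_norm_eq_inner
  by (auto intro!: derivative_eq_intros simp: inner_commute algebra_simps)

text \<open>A derivative is the same function times a linear form, so the induction closes with the
  product rule.\<close>

lemma times_cont_differentiable_exp_norm_square:
  "times_cont_differentiable k (\<lambda>x::'a::real_inner. exp (c * (norm x)\<^sup>2))"
proof (induction k)
  case 0
  then show ?case by (auto intro!: continuous_intros)
next
  case (Suc k)
  then show ?case
    by (intro times_cont_differentiable_SucI[OF has_derivative_exp_norm_square]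
        times_cont_differentiable_mult times_cont_differentiable_inner)
qed

lemma abs_exp_diff_le:
  fixes s t c :: real
  assumes "s \<le> c" "t \<le> c"
  shows "\<bar>exp s - exp t\<bar> \<le> \<bar>s - t\<bar> * exp c"
proof -
  have *: "exp s - exp t \<le> (s - t) * exp s" for s t :: real
  proof -
    have "exp s * (1 + (t - s)) \<le> exp s * exp (t - s)"
      by (intro mult_left_mono exp_ge_add_one_self) simp
    then show ?thesis by (simp add: algebra_simps flip: exp_add)
  qed
  have "exp s - exp t \<le> \<bar>s - t\<bar> * exp c"
    by (rule order_trans[OF *]) (use assms in \<open>auto intro!: mult_mono\<close>)
  moreover have "exp t - exp s \<le> \<bar>s - t\<bar> * exp c"
    by (rule order_trans[OF *]) (use assms in \<open>auto intro!: mult_mono\<close>)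
  ultimately show ?thesis by simp
qed

section \<open>Differentiation under the Gaussian integral\<close>

text \<open>The class of admissible test functions. No continuity is asked, since truncated
  posterior means have to belong to it; the bounded support makes every exponential kernel bounded
  where it matters, so constants serve as majorants. A single \<open>R\<close> bounds both values
  and support.\<close>

definition bounded_support :: "('a::real_normed_vector \<Rightarrow> real) \<Rightarrow> bool" where
  "bounded_support \<theta> \<longleftrightarrow> \<theta> \<in> borel_measurable borel \<and> (\<exists>R\<ge>0. \<forall>y. \<bar>\<theta> y\<bar> \<le> R \<and> (R < norm y \<longrightarrow> \<theta> y = 0))"

lemma bounded_supportE:
  assumes "bounded_support \<theta>"
  obtains R where "0 \<le> R" "\<And>y. \<bar>\<theta> y\<bar> \<le> R" "\<And>y. R < norm y \<Longrightarrow> \<theta> y = 0"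
  using assms unfolding bounded_support_def by blast

lemma bounded_support_measurable: "bounded_support \<theta> \<Longrightarrow> \<theta> \<in> borel_measurable borel"
  by (simp add: bounded_support_def)

text \<open>Each differentiation of the exponential kernel brings down a linear factor in
  \<open>y\<close>. This closure property absorbs it into the test function, because a continuous
  factor is bounded on the ball that carries the support.\<close>

lemma bounded_support_mult_continuous:
  fixes \<theta> f :: "'a::euclidean_space \<Rightarrow> real"
  assumes \<theta>: "bounded_support \<theta>" and f: "continuous_on UNIV f"
  shows "bounded_support (\<lambda>y. f y * \<theta> y)"
proof -
  obtain R where R: "0 \<le> R" "\<And>y. \<bar>\<theta> y\<bar> \<le> R" "\<And>y. R < norm y \<Longrightarrow> \<theta> y = 0"
    using bounded_supportE[OF \<theta>] by blast
  have "compact (f ` cball 0 R)"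
    by (intro compact_continuous_image continuous_on_subset[OF f]) auto
  then obtain K where "\<forall>y\<in>cball 0 R. \<bar>f y\<bar> \<le> K"
    by (auto dest!: compact_imp_bounded simp: bounded_iff)
  then have K: "\<bar>f y\<bar> \<le> K" if "norm y \<le> R" for y
    using that by simp
  have K0: "0 \<le> K" using K[of 0] R(1) by simp
  have b: "\<bar>f y * \<theta> y\<bar> \<le> R + K * R" for y
  proof (cases "norm y \<le> R")
    case True
    then have "\<bar>f y * \<theta> y\<bar> \<le> K * R" using K[of y] R(2)[of y] K0 by (auto simp: abs_mult intro!: mult_mono)
    then show ?thesis using R by simp
  next
    case False
    then show ?thesis using R K0 by simp
  qed
  have "f y * \<theta> y = 0" if "R + K * R < norm y" for y
    using R(3)[of y] that R(1) K0 mult_nonneg_nonneg[OF K0 R(1)] by simp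
  moreover have "f \<in> borel_measurable borel" using f by (rule borel_measurable_continuous_onI)
  moreover have "0 \<le> R + K * R" using R K0 by simp
  ultimately show ?thesis
    using b bounded_support_measurable[OF \<theta>] unfolding bounded_support_def
    by (intro conjI exI[of _ "R + K * R"]) auto
qed

lemma integrable_bounded_support:
  fixes \<theta> f :: "'a::euclidean_space \<Rightarrow> real"
  assumes "finite_measure M" and [simp]: "sets M = sets borel"
    and "bounded_support \<theta>" and f: "continuous_on UNIV f"
  shows "integrable M (\<lambda>y. \<theta> y * f y)"
proof -
  interpret finite_measure M by fact
  have s: "bounded_support (\<lambda>y. f y * \<theta> y)" by (rule bounded_support_mult_continuous) fact+
  then obtain R where "\<And>y. \<bar>f y * \<theta> y\<bar> \<le> R" using bounded_supportE by blast
  moreover have "(\<lambda>y. f y * \<theta> y) \<in> borel_measurable M"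
    using bounded_support_measurable[OF s] by (simp cong: measurable_cong_sets)
  ultimately have "integrable M (\<lambda>y. f y * \<theta> y)" by (intro integrable_const_bound[of _ R]) auto
  then show ?thesis by (simp add: mult.commute)
qed

text \<open>The derivative has the shape of the original integral with \<open>\<theta> y\<close>
  replaced by \<open>a * (h \<bullet> y) * \<theta> y\<close>, which is what allows iteration to all
  orders.\<close>

lemma has_derivative_integral_exp_inner:
  fixes M :: "'a::euclidean_space measure"
  assumes "finite_measure M" and [simp]: "sets M = sets borel"
    and \<theta>: "bounded_support \<theta>"
  shows "((\<lambda>x. \<integral>y. \<theta> y * exp (a * (x \<bullet> y)) \<partial>M) has_derivative
    (\<lambda>h. \<integral>y. (a * (h \<bullet> y) * \<theta> y) * exp (a * (x \<bullet> y)) \<partial>M)) (at x)"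
proof -
  interpret finite_measure M by fact
  obtain R where R: "0 \<le> R" "\<And>y. \<bar>\<theta> y\<bar> \<le> R" "\<And>y. R < norm y \<Longrightarrow> \<theta> y = 0"
    using bounded_supportE[OF \<theta>] by blast
  \<comment> \<open>Bounds the kernel simultaneously for all \<open>u\<close> in the unit ball about
    \<open>x\<close>, where \<open>norm u \<le> norm x + 1\<close>, and all \<open>y\<close> in the
    support.\<close>
  let ?E = "exp (\<bar>a\<bar> * ((norm x + 1) * R))"
  have le: "a * (u \<bullet> y) \<le> \<bar>a\<bar> * ((norm x + 1) * R)" if "norm y \<le> R" "norm (u - x) < 1" for u y
  proof -
    have "a * (u \<bullet> y) \<le> \<bar>a\<bar> * \<bar>u \<bullet> y\<bar>" by (simp add: abs_ge_self flip: abs_mult)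
    also have "\<bar>u \<bullet> y\<bar> \<le> norm u * norm y" by (rule Cauchy_Schwarz_ineq2)
    also have "\<dots> \<le> (norm x + 1) * R"
      using that norm_triangle_ineq[of x "u - x"] by (intro mult_mono) auto
    finally show ?thesis by (simp add: mult_left_mono)
  qed
  have ip: "\<bar>a * (h \<bullet> y)\<bar> \<le> \<bar>a\<bar> * R * norm h" if "norm y \<le> R" for h y
  proof -
    have "\<bar>h \<bullet> y\<bar> \<le> norm h * norm y" by (rule Cauchy_Schwarz_ineq2)
    also have "\<dots> \<le> norm h * R" using that by (intro mult_left_mono) auto
    finally show ?thesis by (simp add: abs_mult mult_left_mono mult.assoc mult.commute[of R])
  qed
  show ?thesis
  proof (rule has_derivative_lebesgue_integral[of 1 x M _ _ "\<lambda>_. R * (\<bar>a\<bar> * R * ?E)"])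
    show "integrable M (\<lambda>y. \<theta> y * exp (a * (u \<bullet> y)))" for u
      by (intro integrable_bounded_support assms continuous_intros)
    show "((\<lambda>x. \<theta> y * exp (a * (x \<bullet> y))) has_derivative (\<lambda>h. a * (h \<bullet> y) * \<theta> y * exp (a * (x \<bullet> y)))) (at x)" for y
      by (auto intro!: derivative_eq_intros simp: algebra_simps)
    show "(\<lambda>y. a * (h \<bullet> y) * \<theta> y * exp (a * (x \<bullet> y))) \<in> borel_measurable M" for h
      using bounded_support_measurable[OF \<theta>] by (simp cong: measurable_cong_sets)
    show "\<bar>a * (h \<bullet> y) * \<theta> y * exp (a * (x \<bullet> y))\<bar> \<le> R * (\<bar>a\<bar> * R * ?E) * norm h" for h y
    proof (cases "norm y \<le> R")
      case True
      have "\<bar>a * (h \<bullet> y) * \<theta> y * exp (a * (x \<bullet> y))\<bar> = \<bar>a * (h \<bullet> y)\<bar> * \<bar>\<theta> y\<bar> * exp (a * (x \<bullet> y))"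
        by (simp add: abs_mult)
      also have "\<dots> \<le> (\<bar>a\<bar> * R * norm h) * R * ?E"
        using ip[OF True, of h] le[OF True, of x] R by (intro mult_mono) auto
      finally show ?thesis by (simp add: mult_ac)
    next
      case False
      then show ?thesis using R by simp
    qed
    show "\<bar>\<theta> y * exp (a * (u \<bullet> y)) - \<theta> y * exp (a * (x \<bullet> y))\<bar> \<le> R * (\<bar>a\<bar> * R * ?E) * norm (u - x)"
      if "u \<in> ball x 1" for u y
    proof (cases "norm y \<le> R")
      case True
      have "norm (u - x) < 1" using that by (simp add: dist_norm norm_minus_commute)
      then have "\<bar>exp (a * (u \<bullet> y)) - exp (a * (x \<bullet> y))\<bar> \<le> \<bar>a * (u \<bullet> y) - a * (x \<bullet> y)\<bar> * ?E"
        using le[OF True] by (intro abs_exp_diff_le) auto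
      also have "a * (u \<bullet> y) - a * (x \<bullet> y) = a * ((u - x) \<bullet> y)" by (simp add: algebra_simps)
      also have "\<bar>\<dots>\<bar> * ?E \<le> \<bar>a\<bar> * R * norm (u - x) * ?E"
        using ip[OF True] by (intro mult_right_mono) auto
      finally have "\<bar>\<theta> y\<bar> * \<bar>exp (a * (u \<bullet> y)) - exp (a * (x \<bullet> y))\<bar> \<le> R * (\<bar>a\<bar> * R * norm (u - x) * ?E)"
        using R by (intro mult_mono) auto
      then show ?thesis by (simp add: mult_ac flip: abs_mult right_diff_distrib)
    next
      case False
      then show ?thesis using R by simp
    qed
  qed simp_all
qed

lemma times_cont_differentiable_integral_exp_inner:
  fixes M :: "'a::euclidean_space measure"
  assumes M: "finite_measure M" "sets M = sets borel"
  shows "bounded_support \<theta> \<Longrightarrow> times_cont_differentiable k (\<lambda>x. \<integral>y. \<theta> y * exp (a * (x \<bullet> y)) \<partial>M)"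
proof (induction k arbitrary: \<theta>)
  case 0
  then show ?case
    using has_derivative_continuous[OF has_derivative_integral_exp_inner[OF M]]
    by (auto intro!: continuous_at_imp_continuous_on)
next
  case (Suc k)
  show ?case
    by (rule times_cont_differentiable_SucI[OF has_derivative_integral_exp_inner[OF M Suc.prems]])
      (intro Suc.IH bounded_support_mult_continuous Suc.prems continuous_intros)
qed

text \<open>Taking \<open>v\<close> to be the gradient itself turns its squared norm into one
  directional derivative.\<close>

lemma inner_gradient:
  assumes "(f has_derivative D) (at x)"
  shows "v \<bullet> gradient f x = D v"
proof -
  interpret D: bounded_linear D using assms by (rule has_derivative_bounded_linear)
  have "v \<bullet> gradient f x = (\<Sum>i\<in>UNIV. v $ i * D (axis i 1))"
    by (simp add: gradient_def inner_vec_def frechet_derivative_eqI[OF assms])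
  also have "\<dots> = D (\<Sum>i\<in>UNIV. v $ i *\<^sub>R axis i 1)"
    by (simp add: D.sum D.scaleR)
  also have "(\<Sum>i\<in>UNIV. v $ i *\<^sub>R axis i 1) = v"
    using basis_expansion[of v] by (simp add: scalar_mult_eq_scaleR)
  finally show ?thesis .
qed

text \<open>This is \<open>E \<psi>(a x + G)\<close>, the conditional expectation of
  \<open>\<psi>(Y)\<close> given \<open>X = x\<close>, rewritten by Cameron--Martin. In this form
  \<open>x\<close> does not occur inside \<open>\<psi>\<close>, so smoothness in \<open>x\<close> is
  inherited from the kernel.\<close>

definition gaussian_smoothing :: "real \<Rightarrow> (real ^ 'n \<Rightarrow> real) \<Rightarrow> real ^ 'n \<Rightarrow> real" where
  "gaussian_smoothing a \<psi> x = (\<integral>y. \<psi> y * exp (a * (x \<bullet> y) - a\<^sup>2 * (norm x)\<^sup>2 / 2) \<partial>std_gaussian)"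

lemma gaussian_smoothing_altdef:
  "gaussian_smoothing a \<psi> =
    (\<lambda>x. exp (- (a\<^sup>2 / 2) * (norm x)\<^sup>2) * (\<integral>y. \<psi> y * exp (a * (x \<bullet> y)) \<partial>std_gaussian))"
  unfolding gaussian_smoothing_def integral_mult_right_zero[symmetric]
  by (intro ext Bochner_Integration.integral_cong refl) (simp add: mult_ac flip: exp_add)

context
  fixes \<psi> :: "real ^ 'n \<Rightarrow> real" and a :: real
  assumes \<psi>: "bounded_support \<psi>"
begin

interpretation prob_space "std_gaussian :: (real ^ 'n) measure" by (rule prob_space_std_gaussian)

lemma smooth_gaussian_smoothing: "smooth (gaussian_smoothing a \<psi>)"
  unfolding smooth_def gaussian_smoothing_altdef
  by (intro allI times_cont_differentiable_mult times_cont_differentiable_exp_norm_square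
      times_cont_differentiable_integral_exp_inner \<psi>) (auto intro: finite_measure_axioms)

text \<open>The two terms of the product rule are merged into the factor
  \<open>y - a *\<^sub>R x\<close> because, after undoing the shift, that factor is the standard
  Gaussian noise.\<close>

lemma has_derivative_gaussian_smoothing:
  "(gaussian_smoothing a \<psi> has_derivative
    (\<lambda>h. a * (\<integral>y. \<psi> y * (h \<bullet> (y - a *\<^sub>R x)) * exp (a * (x \<bullet> y) - a\<^sup>2 * (norm x)\<^sup>2 / 2) \<partial>std_gaussian))) (at x)"
proof -
  let ?e = "exp (- (a\<^sup>2 / 2) * (norm x)\<^sup>2)"
  have e: "exp (a * (x \<bullet> y) - a\<^sup>2 * (norm x)\<^sup>2 / 2) = ?e * exp (a * (x \<bullet> y))" for y
    by (simp flip: exp_add)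
  have int: "integrable std_gaussian (\<lambda>y. \<psi> y * f y)" if "continuous_on UNIV f" for f
    by (intro integrable_bounded_support \<psi> that) (auto intro: finite_measure_axioms)
  have "(gaussian_smoothing a \<psi> has_derivative (\<lambda>h.
    ?e * (\<integral>y. (a * (h \<bullet> y) * \<psi> y) * exp (a * (x \<bullet> y)) \<partial>std_gaussian) +
      (2 * (- (a\<^sup>2 / 2)) * (x \<bullet> h) * ?e) * (\<integral>y. \<psi> y * exp (a * (x \<bullet> y)) \<partial>std_gaussian))) (at x)"
    unfolding gaussian_smoothing_altdef
    by (intro has_derivative_mult has_derivative_exp_norm_square has_derivative_integral_exp_inner \<psi>)
      (auto intro: finite_measure_axioms)
  also have "(\<lambda>h. ?e * (\<integral>y. (a * (h \<bullet> y) * \<psi> y) * exp (a * (x \<bullet> y)) \<partial>std_gaussian) +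
      (2 * (- (a\<^sup>2 / 2)) * (x \<bullet> h) * ?e) * (\<integral>y. \<psi> y * exp (a * (x \<bullet> y)) \<partial>std_gaussian)) =
    (\<lambda>h. \<integral>y. \<psi> y * (?e * a * (h \<bullet> y) * exp (a * (x \<bullet> y))) +
       \<psi> y * ((- a\<^sup>2 * (x \<bullet> h) * ?e) * exp (a * (x \<bullet> y))) \<partial>std_gaussian)"
    (is "?l = ?r")
  proof
    fix h
    have "?r h = (\<integral>y. \<psi> y * (?e * a * (h \<bullet> y) * exp (a * (x \<bullet> y))) \<partial>std_gaussian) +
       (\<integral>y. \<psi> y * ((- a\<^sup>2 * (x \<bullet> h) * ?e) * exp (a * (x \<bullet> y))) \<partial>std_gaussian)"
      by (intro Bochner_Integration.integral_add int continuous_intros)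
    also have "\<dots> = ?l h"
      unfolding integral_mult_right_zero[symmetric]
      by (intro arg_cong2[of _ _ _ _ "(+)"] Bochner_Integration.integral_cong refl) (simp_all add: mult_ac)
    finally show "?l h = ?r h" ..
  qed
  also have "\<dots> = (\<lambda>h. a * (\<integral>y. \<psi> y * (h \<bullet> (y - a *\<^sub>R x)) *
      exp (a * (x \<bullet> y) - a\<^sup>2 * (norm x)\<^sup>2 / 2) \<partial>std_gaussian))"
    unfolding integral_mult_right_zero[symmetric] e
    by (intro ext Bochner_Integration.integral_cong refl)
      (simp add: inner_diff_right inner_commute algebra_simps power2_eq_square)
  finally show ?thesis .
qed

end

section \<open>The likelihood ratio of the shifted Gaussian\<close>

text \<open>The density at \<open>y\<close> of the law of \<open>a x + G\<close> with respect to the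
  standard Gaussian: the likelihood in Bayes' formula, and the kernel of
  \<open>gaussian_smoothing\<close>.\<close>

definition weight :: "real \<Rightarrow> real ^ 'n \<Rightarrow> real ^ 'n \<Rightarrow> real" where
  "weight a x y = exp (a * (x \<bullet> y) - a\<^sup>2 * (norm x)\<^sup>2 / 2)"

lemma weight_pos [simp]: "0 < weight a x y"
  and weight_nonneg [simp]: "0 \<le> weight a x y"
  and weight_0 [simp]: "weight 0 x y = 1"
  by (simp_all add: weight_def)

text \<open>From \<open>|y - a x|^2 \<ge> 0\<close>. The bound does not depend on \<open>a\<close>
  or \<open>x\<close>, so for fixed \<open>y\<close> any \<mu>-integrable function stays integrable
  when weighted, without tail assumptions on \<mu>.\<close>

lemma weight_le: "weight a x y \<le> exp ((norm y)\<^sup>2 / 2)"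
proof -
  have "0 \<le> (norm (y - a *\<^sub>R x))\<^sup>2" by simp
  then show ?thesis
    unfolding weight_def power2_norm_eq_inner
    by (simp add: inner_diff_left inner_diff_right inner_commute power2_eq_square algebra_simps)
qed

lemma borel_measurable_weight [measurable]:
  assumes [measurable]: "f \<in> borel_measurable M" "X \<in> measurable M borel" "Y \<in> measurable M borel"
  shows "(\<lambda>z. weight (f z) (X z) (Y z)) \<in> borel_measurable M"
  unfolding weight_def by measurable

lemma nn_integral_weight_std_gaussian:
  fixes x :: "real ^ 'n"
  assumes "f \<in> borel_measurable borel"
  shows "(\<integral>\<^sup>+y. ennreal (weight a x y) * f y \<partial>std_gaussian) = (\<integral>\<^sup>+g. f (a *\<^sub>R x + g) \<partial>std_gaussian)"
  using nn_integral_std_gaussian_shift[OF assms, of "a *\<^sub>R x"] by (simp add: weight_def power_mult_distrib)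

lemma integral_weight_std_gaussian:
  fixes x :: "real ^ 'n" and f :: "real ^ 'n \<Rightarrow> real"
  assumes [measurable]: "f \<in> borel_measurable borel"
  shows "(\<integral>y. weight a x y * f y \<partial>std_gaussian) = (\<integral>g. f (a *\<^sub>R x + g) \<partial>std_gaussian)"
proof -
  have eq: "distr std_gaussian borel (\<lambda>g. a *\<^sub>R x + g) = density std_gaussian (\<lambda>y. ennreal (weight a x y))"
    using distr_std_gaussian_shift[of "a *\<^sub>R x"] by (simp add: weight_def power_mult_distrib)
  have "integral\<^sup>L (distr std_gaussian borel (\<lambda>g. a *\<^sub>R x + g)) f = (\<integral>g. f (a *\<^sub>R x + g) \<partial>std_gaussian)"
    by (subst integral_distr) auto
  moreover have "integral\<^sup>L (density std_gaussian (\<lambda>y. ennreal (weight a x y))) f =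
      (\<integral>y. weight a x y * f y \<partial>std_gaussian)"
    by (subst integral_real_density) auto
  ultimately show "(\<integral>y. weight a x y * f y \<partial>std_gaussian) = (\<integral>g. f (a *\<^sub>R x + g) \<partial>std_gaussian)"
    using eq by simp
qed

lemma gaussian_smoothing_eq_weight:
  "gaussian_smoothing a \<psi> x = (\<integral>y. weight a x y * \<psi> y \<partial>std_gaussian)"
  by (simp add: gaussian_smoothing_def weight_def mult.commute)

lemma abs_gaussian_smoothing_le:
  fixes x :: "real ^ 'n"
  assumes \<psi>: "\<psi> \<in> borel_measurable borel" and b: "\<And>y. \<bar>\<psi> y\<bar> \<le> K"
  shows "\<bar>gaussian_smoothing a \<psi> x\<bar> \<le> K"
proof -
  interpret prob_space "std_gaussian :: (real ^ 'n) measure" by (rule prob_space_std_gaussian)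
  have m: "(\<lambda>g. \<psi> (a *\<^sub>R x + g)) \<in> borel_measurable std_gaussian" using \<psi> by measurable
  have "\<bar>gaussian_smoothing a \<psi> x\<bar> = \<bar>\<integral>g. \<psi> (a *\<^sub>R x + g) \<partial>std_gaussian\<bar>"
    unfolding gaussian_smoothing_eq_weight integral_weight_std_gaussian[OF \<psi>] ..
  also have "\<dots> \<le> (\<integral>g. \<bar>\<psi> (a *\<^sub>R x + g)\<bar> \<partial>std_gaussian)"
    by (rule integral_abs_bound)
  also have "\<dots> \<le> (\<integral>g. K \<partial>(std_gaussian :: (real ^ 'n) measure))"
  proof (rule Bochner_Integration.integral_mono)
    show "integrable std_gaussian (\<lambda>g. \<bar>\<psi> (a *\<^sub>R x + g)\<bar>)"
      using m b by (intro integrable_const_bound[of _ K]) auto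
  qed (use b in auto)
  also have "\<dots> = K" using prob_space by simp
  finally show ?thesis .
qed

text \<open>The gradient is \<open>a E[\<psi>(a x + G) G]\<close>: the derivative falls on the
  kernel and never on \<open>\<psi>\<close>. Testing against \<open>v\<close>, the gradient itself,
  leaves a single Gaussian direction, whose second moment is at most \<open>|v|^2\<close>;
  Cauchy--Schwarz then gives the claim multiplied by \<open>|v|^2\<close>, which cancels unless it
  vanishes.\<close>

lemma norm_gradient_gaussian_smoothing_le:
  fixes x :: "real ^ 'n"
  assumes \<psi>: "bounded_support \<psi>"
  shows "(norm (gradient (gaussian_smoothing a \<psi>) x))\<^sup>2 \<le> a\<^sup>2 * gaussian_smoothing a (\<lambda>y. (\<psi> y)\<^sup>2) x"
proof -
  interpret prob_space "std_gaussian :: (real ^ 'n) measure" by (rule prob_space_std_gaussian)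
  have [measurable]: "\<psi> \<in> borel_measurable borel" using \<psi> by (rule bounded_support_measurable)
  obtain K where K: "\<And>y. \<bar>\<psi> y\<bar> \<le> K" using bounded_supportE[OF \<psi>] by blast
  define v where "v = gradient (gaussian_smoothing a \<psi>) x"
  let ?f = "\<lambda>g. \<psi> (a *\<^sub>R x + g)"
  have "v \<bullet> v = a * (\<integral>y. \<psi> y * (v \<bullet> (y - a *\<^sub>R x)) * exp (a * (x \<bullet> y) - a\<^sup>2 * (norm x)\<^sup>2 / 2) \<partial>std_gaussian)"
    using inner_gradient[OF has_derivative_gaussian_smoothing[OF \<psi>], of v] unfolding v_def .
  also have "\<dots> = a * (\<integral>y. weight a x y * (\<psi> y * (v \<bullet> (y - a *\<^sub>R x))) \<partial>std_gaussian)"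
    by (simp add: weight_def mult_ac)
  also have "\<dots> = a * (\<integral>g. ?f g * (v \<bullet> g) \<partial>std_gaussian)"
    by (subst integral_weight_std_gaussian) auto
  finally have "((norm v)\<^sup>2)\<^sup>2 = a\<^sup>2 * (\<integral>g. ?f g * (v \<bullet> g) \<partial>std_gaussian)\<^sup>2"
    by (simp add: power2_norm_eq_inner power_mult_distrib)
  also have "\<dots> \<le> a\<^sup>2 * ((\<integral>g. (?f g)\<^sup>2 \<partial>std_gaussian) * (\<integral>g. (v \<bullet> g)\<^sup>2 \<partial>std_gaussian))"
  proof (intro mult_left_mono integral_Cauchy_Schwarz integrable_std_gaussian_inner_square)
    have "(?f g)\<^sup>2 \<le> K\<^sup>2" for g using K[of "a *\<^sub>R x + g"] by (metis abs_ge_zero power2_abs power_mono)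
    then show "integrable std_gaussian (\<lambda>g. (?f g)\<^sup>2)"
      by (intro integrable_const_bound[of _ "K\<^sup>2"]) auto
  qed auto
  also have "\<dots> \<le> a\<^sup>2 * ((\<integral>g. (?f g)\<^sup>2 \<partial>std_gaussian) * (norm v)\<^sup>2)"
    by (intro mult_left_mono integral_std_gaussian_inner_square) auto
  also have "(\<integral>g. (?f g)\<^sup>2 \<partial>std_gaussian) = gaussian_smoothing a (\<lambda>y. (\<psi> y)\<^sup>2) x"
    unfolding gaussian_smoothing_eq_weight by (subst integral_weight_std_gaussian) auto
  finally have *: "(norm v)\<^sup>2 * (norm v)\<^sup>2 \<le> (a\<^sup>2 * gaussian_smoothing a (\<lambda>y. (\<psi> y)\<^sup>2) x) * (norm v)\<^sup>2"
    by (simp add: power2_eq_square[of "(norm v)\<^sup>2"] mult_ac)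
  have "0 \<le> gaussian_smoothing a (\<lambda>y. (\<psi> y)\<^sup>2) x"
    unfolding gaussian_smoothing_eq_weight by simp
  with * show ?thesis
    unfolding v_def[symmetric] by (cases "v = 0") (auto intro: mult_right_le_imp_le[OF *])
qed

text \<open>A majorant independent of \<open>z\<close> and uniform over a bounded range of
  \<open>a\<close>, for dominated convergence along the path.\<close>

lemma weight_path_le:
  assumes "\<bar>a\<bar> \<le> r"
  shows "weight a z (a *\<^sub>R x + g) \<le> exp ((r * norm x + norm g)\<^sup>2 / 2)"
proof -
  have "norm (a *\<^sub>R x + g) \<le> \<bar>a\<bar> * norm x + norm g"
    by (rule order_trans[OF norm_triangle_ineq]) simp
  also have "\<dots> \<le> r * norm x + norm g" using assms by (simp add: mult_right_mono)
  finally have "(norm (a *\<^sub>R x + g))\<^sup>2 \<le> (r * norm x + norm g)\<^sup>2" by (intro power_mono) auto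
  then show ?thesis by (intro order_trans[OF weight_le]) simp
qed

text \<open>Along the path the exponent is
  \<open>a (z \<bullet> g) + a^2 (z \<bullet> x) - a^2 |z|^2 / 2\<close>. The factor 2 at
  \<open>z \<bullet> x\<close> arises because \<open>a\<close> moves both the likelihood and the
  point at which it is evaluated.\<close>

lemma has_real_derivative_weight_path:
  "((\<lambda>a. weight a z (a *\<^sub>R x + g)) has_real_derivative
    (z \<bullet> g + 2 * a * (z \<bullet> x) - a * (norm z)\<^sup>2) * weight a z (a *\<^sub>R x + g)) (at a)"
  unfolding weight_def inner_add_right inner_scaleR_right
  by (auto intro!: derivative_eq_intros simp: algebra_simps)

subsection \<open>The Gaussian channel\<close>

locale gaussian_channel = prob_space \<mu> for \<mu> :: "(real ^ 'n) measure" +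
  assumes sets_eq_borel [simp, measurable_cong]: "sets \<mu> = sets borel"
    and integrable_norm_square: "integrable \<mu> (\<lambda>x. (norm x)\<^sup>2)"
    and integral_id: "(\<integral>x. x \<partial>\<mu>) = 0"
begin

text \<open>The second coordinate has two readings: the noise \<open>g\<close> before the change of
  variables, and the observation \<open>y\<close> once the weight has been inserted as a
  density.\<close>

abbreviation joint :: "((real ^ 'n) \<times> (real ^ 'n)) measure" where
  "joint \<equiv> \<mu> \<Otimes>\<^sub>M std_gaussian"

lemma space_eq [simp]: "space \<mu> = UNIV"
  using sets_eq_imp_space_eq[OF sets_eq_borel] by simp

sublocale gauss: prob_space "std_gaussian :: (real ^ 'n) measure"
  by (rule prob_space_std_gaussian)

sublocale pair: pair_prob_space \<mu> "std_gaussian :: (real ^ 'n) measure" ..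

lemma integrable_id: "integrable \<mu> (\<lambda>x. x)"
proof (rule Bochner_Integration.integrable_bound[of \<mu> "\<lambda>x. 1 + (norm x)\<^sup>2"])
  have "norm x \<le> 1 + (norm x)\<^sup>2" for x :: "real ^ 'n"
    using sum_squares_bound[of 1 "norm x"] norm_ge_zero[of x] unfolding power_one by linarith
  then show "AE x in \<mu>. norm x \<le> norm (1 + (norm x)\<^sup>2)" by auto
qed (use integrable_norm_square in auto)

text \<open>Cameron--Martin applied fibrewise for each fixed \<open>x\<close>. The channel becomes a
  change of density on a product space, and the two orders of Fubini then condition on the input and
  on the output respectively.\<close>

lemma distr_channel:
  "distr joint (borel \<Otimes>\<^sub>M borel) (\<lambda>(x, g). (x, a *\<^sub>R x + g)) =
    density joint (\<lambda>(x, y). ennreal (weight a x y))"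
proof (rule measure_eqI)
  have s: "sets joint = sets (borel \<Otimes>\<^sub>M borel)" by (intro sets_pair_measure_cong) auto
  then show "sets (distr joint (borel \<Otimes>\<^sub>M borel) (\<lambda>(x, g). (x, a *\<^sub>R x + g))) =
    sets (density joint (\<lambda>(x, y). ennreal (weight a x y)))" by simp
  fix A assume "A \<in> sets (distr joint (borel \<Otimes>\<^sub>M borel) (\<lambda>(x, g). (x, a *\<^sub>R x + g)))"
  then have [measurable]: "A \<in> sets (borel \<Otimes>\<^sub>M borel)" by simp
  then have [measurable]: "A \<in> sets joint" using s by simp
  have "emeasure (distr joint (borel \<Otimes>\<^sub>M borel) (\<lambda>(x, g). (x, a *\<^sub>R x + g))) A
      = (\<integral>\<^sup>+z. indicator A (fst z, a *\<^sub>R fst z + snd z) \<partial>joint)"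
    by (simp add: nn_integral_distr case_prod_beta flip: nn_integral_indicator)
  also have "\<dots> = (\<integral>\<^sup>+x. \<integral>\<^sup>+g. indicator A (x, a *\<^sub>R x + g) \<partial>std_gaussian \<partial>\<mu>)"
    by (subst gauss.nn_integral_fst[symmetric]) auto
  also have "\<dots> = (\<integral>\<^sup>+x. \<integral>\<^sup>+y. ennreal (weight a x y) * indicator A (x, y) \<partial>std_gaussian \<partial>\<mu>)"
    by (intro nn_integral_cong nn_integral_weight_std_gaussian[symmetric]) simp
  also have "\<dots> = (\<integral>\<^sup>+z. ennreal (weight a (fst z) (snd z)) * indicator A z \<partial>joint)"
    by (subst gauss.nn_integral_fst[symmetric]) auto
  also have "\<dots> = emeasure (density joint (\<lambda>(x, y). ennreal (weight a x y))) A"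
    by (subst emeasure_density) (auto simp: case_prod_beta)
  finally show "emeasure (distr joint (borel \<Otimes>\<^sub>M borel) (\<lambda>(x, g). (x, a *\<^sub>R x + g))) A =
    emeasure (density joint (\<lambda>(x, y). ennreal (weight a x y))) A" .
qed

lemma
  fixes f :: "real ^ 'n \<Rightarrow> real ^ 'n \<Rightarrow> real"
  assumes [measurable]: "(\<lambda>(x, y). f x y) \<in> borel_measurable (borel \<Otimes>\<^sub>M borel)"
  shows integrable_channel: "integrable joint (\<lambda>(x, g). f x (a *\<^sub>R x + g)) \<longleftrightarrow>
      integrable joint (\<lambda>(x, y). weight a x y * f x y)"
    and integral_channel: "(\<integral>(x, g). f x (a *\<^sub>R x + g) \<partial>joint) = (\<integral>(x, y). weight a x y * f x y \<partial>joint)"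
proof -
  let ?T = "\<lambda>(x, g). (x :: real ^ 'n, a *\<^sub>R x + g)" and ?f = "\<lambda>(x, y). f x y"
  have "integrable (distr joint (borel \<Otimes>\<^sub>M borel) ?T) ?f \<longleftrightarrow> integrable joint (\<lambda>(x, g). f x (a *\<^sub>R x + g))"
    by (subst integrable_distr_eq) (auto simp: case_prod_beta')
  moreover have "integrable (density joint (\<lambda>(x, y). ennreal (weight a x y))) ?f \<longleftrightarrow>
      integrable joint (\<lambda>(x, y). weight a x y * f x y)"
    unfolding case_prod_beta
    by (subst integrable_real_density) auto
  ultimately show "integrable joint (\<lambda>(x, g). f x (a *\<^sub>R x + g)) \<longleftrightarrow>
      integrable joint (\<lambda>(x, y). weight a x y * f x y)"
    unfolding distr_channel by simp
  have "integral\<^sup>L (distr joint (borel \<Otimes>\<^sub>M borel) ?T) ?f = (\<integral>(x, g). f x (a *\<^sub>R x + g) \<partial>joint)"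
    by (subst integral_distr) (auto simp: case_prod_beta')
  moreover have "integral\<^sup>L (density joint (\<lambda>(x, y). ennreal (weight a x y))) ?f =
      (\<integral>(x, y). weight a x y * f x y \<partial>joint)"
    unfolding case_prod_beta
    by (subst integral_real_density) auto
  ultimately show "(\<integral>(x, g). f x (a *\<^sub>R x + g) \<partial>joint) = (\<integral>(x, y). weight a x y * f x y \<partial>joint)"
    unfolding distr_channel by simp
qed

section \<open>Posterior quantities given the output\<close>

text \<open>The density of the law of \<open>a X + G\<close> relative to the Gaussian rather than to
  Lebesgue measure, so that at \<open>a = 1\<close> its logarithm is the integrand of the relative
  entropy.\<close>

definition output_density :: "real \<Rightarrow> real ^ 'n \<Rightarrow> real" where
  "output_density a y = (\<integral>x. weight a x y \<partial>\<mu>)"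

definition posterior_mean :: "real \<Rightarrow> real ^ 'n \<Rightarrow> real ^ 'n" where
  "posterior_mean a y = (\<integral>x. weight a x y *\<^sub>R x \<partial>\<mu>) /\<^sub>R output_density a y"

definition posterior_second_moment :: "real \<Rightarrow> real ^ 'n \<Rightarrow> real" where
  "posterior_second_moment a y = (\<integral>x. weight a x y * (norm x)\<^sup>2 \<partial>\<mu>) / output_density a y"

lemma borel_measurable_channel [measurable]:
  assumes [measurable]: "f \<in> borel_measurable M" "Y \<in> measurable M borel"
  shows "(\<lambda>z. output_density (f z) (Y z)) \<in> borel_measurable M"
    and "(\<lambda>z. posterior_mean (f z) (Y z)) \<in> borel_measurable M"
    and "(\<lambda>z. posterior_second_moment (f z) (Y z)) \<in> borel_measurable M"
  unfolding output_density_def posterior_mean_def posterior_second_moment_def by measurable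

lemma integrable_weight_scaleR:
  fixes k :: "real ^ 'n \<Rightarrow> 'c::{banach, second_countable_topology}"
  assumes k: "integrable \<mu> k"
  shows "integrable \<mu> (\<lambda>x. weight a x y *\<^sub>R k x)"
proof (rule Bochner_Integration.integrable_bound)
  show "integrable \<mu> (\<lambda>x. exp ((norm y)\<^sup>2 / 2) *\<^sub>R k x)" using k by simp
  show "(\<lambda>x. weight a x y *\<^sub>R k x) \<in> borel_measurable \<mu>" using k by measurable
  show "AE x in \<mu>. norm (weight a x y *\<^sub>R k x) \<le> norm (exp ((norm y)\<^sup>2 / 2) *\<^sub>R k x)"
    by (intro AE_I2) (auto intro!: mult_right_mono weight_le)
qed

lemma integrable_weight: "integrable \<mu> (\<lambda>x. weight a x y)"
  using integrable_weight_scaleR[of "\<lambda>_. 1 :: real"] by simp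

lemma output_density_pos: "0 < output_density a y"
proof -
  have "\<not> (AE x in \<mu>. weight a x y = 0)"
    using weight_pos[of a _ y] by (simp add: less_imp_neq[symmetric] AE_False)
  then have "output_density a y \<noteq> 0"
    unfolding output_density_def using integral_nonneg_eq_0_iff_AE[OF integrable_weight] by simp
  moreover have "0 \<le> output_density a y" unfolding output_density_def by simp
  ultimately show ?thesis by simp
qed

lemma output_density_0 [simp]: "output_density 0 y = 1"
  using prob_space by (simp add: output_density_def)

lemma integral_weight_scaleR_id:
  "(\<integral>x. weight a x y *\<^sub>R x \<partial>\<mu>) = output_density a y *\<^sub>R posterior_mean a y"
  using output_density_pos[of a y] by (simp add: posterior_mean_def)

lemma integral_weight_norm_square:
  "(\<integral>x. weight a x y * (norm x)\<^sup>2 \<partial>\<mu>) = output_density a y * posterior_second_moment a y"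
  using output_density_pos[of a y] by (simp add: posterior_second_moment_def)

lemma
  assumes [measurable]: "f \<in> borel_measurable borel"
    and f: "integrable joint (\<lambda>(x, g). f (a *\<^sub>R x + g))"
  shows integrable_output: "integrable std_gaussian (\<lambda>y. output_density a y * f y)"
    and integral_output: "(\<integral>(x, g). f (a *\<^sub>R x + g) \<partial>joint) = (\<integral>y. output_density a y * f y \<partial>std_gaussian)"
proof -
  have i: "integrable joint (\<lambda>(x, y). weight a x y * f y)"
    using f by (subst (asm) integrable_channel) auto
  from pair.integrable_snd[OF this] show "integrable std_gaussian (\<lambda>y. output_density a y * f y)"
    by (simp add: output_density_def)
  from pair.integral_snd[OF i] show "(\<integral>(x, g). f (a *\<^sub>R x + g) \<partial>joint) = (\<integral>y. output_density a y * f y \<partial>std_gaussian)"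
    by (subst integral_channel) (auto simp: output_density_def)
qed

lemma
  fixes f :: "real ^ 'n \<Rightarrow> real"
  shows integrable_joint_fst: "integrable \<mu> f \<Longrightarrow> integrable joint (\<lambda>(x, g). f x)"
    and integral_joint_fst: "integrable \<mu> f \<Longrightarrow> (\<integral>(x, g). f x \<partial>joint) = (\<integral>x. f x \<partial>\<mu>)"
    and integrable_joint_snd: "integrable std_gaussian f \<Longrightarrow> integrable joint (\<lambda>(x, g). f g)"
    and integral_joint_snd: "integrable std_gaussian f \<Longrightarrow> (\<integral>(x, g). f g \<partial>joint) = (\<integral>g. f g \<partial>std_gaussian)"
proof -
  assume f: "integrable \<mu> f"
  then have [measurable]: "f \<in> borel_measurable borel" by (simp cong: measurable_cong_sets)
  show i: "integrable joint (\<lambda>(x, g). f x)"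
    using f by (intro pair.Fubini_integrable) (auto simp: gauss.prob_space[simplified])
  show "(\<integral>(x, g). f x \<partial>joint) = (\<integral>x. f x \<partial>\<mu>)"
    using pair.integral_fst[OF i] by (simp add: gauss.prob_space[simplified])
next
  assume f: "integrable std_gaussian f"
  then have [measurable]: "f \<in> borel_measurable borel" by (simp cong: measurable_cong_sets)
  show i: "integrable joint (\<lambda>(x, g). f g)"
    using f by (intro pair.Fubini_integrable) (auto simp: prob_space[simplified])
  show "(\<integral>(x, g). f g \<partial>joint) = (\<integral>g. f g \<partial>std_gaussian)"
    using pair.integral_fst[OF i] by (simp add: prob_space[simplified])
qed

lemma nn_integral_output:
  assumes [measurable]: "f \<in> borel_measurable borel"
  shows "(\<integral>\<^sup>+(x, g). f (a *\<^sub>R x + g) \<partial>joint) = (\<integral>\<^sup>+y. ennreal (output_density a y) * f y \<partial>std_gaussian)"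
proof -
  have "(\<integral>\<^sup>+(x, g). f (a *\<^sub>R x + g) \<partial>joint) = (\<integral>\<^sup>+x. \<integral>\<^sup>+g. f (a *\<^sub>R x + g) \<partial>std_gaussian \<partial>\<mu>)"
    by (subst gauss.nn_integral_fst[symmetric]) (auto simp: case_prod_beta)
  also have "\<dots> = (\<integral>\<^sup>+x. \<integral>\<^sup>+y. ennreal (weight a x y) * f y \<partial>std_gaussian \<partial>\<mu>)"
    by (simp add: nn_integral_weight_std_gaussian)
  also have "\<dots> = (\<integral>\<^sup>+y. \<integral>\<^sup>+x. ennreal (weight a x y) * f y \<partial>\<mu> \<partial>std_gaussian)"
    by (rule pair.Fubini'[symmetric]) simp
  also have "\<dots> = (\<integral>\<^sup>+y. ennreal (output_density a y) * f y \<partial>std_gaussian)"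
    by (intro nn_integral_cong)
      (simp add: nn_integral_multc output_density_def nn_integral_eq_integral integrable_weight)
  finally show ?thesis .
qed

text \<open>A converse to \<open>integrable_output\<close>; nonnegativity allows Tonelli to be used
  before any integrability on the product is known.\<close>

lemma integrable_outputI:
  assumes [measurable]: "f \<in> borel_measurable borel" and "\<And>y. 0 \<le> f y"
    and i: "integrable std_gaussian (\<lambda>y. output_density a y * f y)"
  shows "integrable joint (\<lambda>(x, g). f (a *\<^sub>R x + g))"
proof (rule integrableI_nonneg)
  have "(\<integral>\<^sup>+z. ennreal (case z of (x, g) \<Rightarrow> f (a *\<^sub>R x + g)) \<partial>joint) =
      (\<integral>\<^sup>+y. ennreal (output_density a y) * ennreal (f y) \<partial>std_gaussian)"
    by (subst nn_integral_output[symmetric]) (auto simp: case_prod_beta')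
  also have "\<dots> = (\<integral>\<^sup>+y. ennreal (output_density a y * f y) \<partial>std_gaussian)"
    using output_density_pos by (intro nn_integral_cong) (simp add: ennreal_mult less_imp_le assms(2))
  also have "\<dots> < \<infinity>"
    using output_density_pos assms(2) by (subst nn_integral_eq_integral[OF i]) (auto simp: less_imp_le)
  finally show "(\<integral>\<^sup>+z. ennreal (case z of (x, g) \<Rightarrow> f (a *\<^sub>R x + g)) \<partial>joint) < \<infinity>" .
qed (use assms(2) in auto)

text \<open>The derivative of \<open>ln (output_density a (a *\<^sub>R x + g))\<close> in \<open>a\<close>.\<close>

definition score :: "real \<Rightarrow> real ^ 'n \<Rightarrow> real ^ 'n \<Rightarrow> real" where
  "score a x g = posterior_mean a (a *\<^sub>R x + g) \<bullet> (g + (2 * a) *\<^sub>R x) - a * posterior_second_moment a (a *\<^sub>R x + g)"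

lemma borel_measurable_score [measurable]:
  assumes [measurable]: "f \<in> borel_measurable M" "X \<in> measurable M borel" "G \<in> measurable M borel"
  shows "(\<lambda>z. score (f z) (X z) (G z)) \<in> borel_measurable M"
  unfolding score_def by measurable

text \<open>Differentiation under \<mu>. Since the weight is bounded uniformly in \<open>z\<close>
  along the path, only a factor of degree two in \<open>z\<close> remains, and the second moment of
  \<mu> suffices as domination.\<close>

lemma has_real_derivative_output_density:
  "((\<lambda>a. output_density a (a *\<^sub>R x + g)) has_real_derivative
    output_density a (a *\<^sub>R x + g) * score a x g) (at a)"
proof -
  let ?d = "\<lambda>b z. z \<bullet> g + 2 * b * (z \<bullet> x) - b * (norm z)\<^sup>2"
  let ?w = "\<lambda>b z. weight b z (b *\<^sub>R x + g)"
  \<comment> \<open>Bounds \<open>|b|\<close> on the unit ball about \<open>a\<close>. The majorant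
    \<open>?B\<close> thus controls the derivative throughout that ball, and by the mean value
    inequality also the increments.\<close>
  let ?r = "\<bar>a\<bar> + 1"
  let ?E = "exp ((?r * norm x + norm g)\<^sup>2 / 2)"
  let ?B = "\<lambda>z. (norm z * (norm g + 2 * ?r * norm x) + ?r * (norm z)\<^sup>2) * ?E"
  have d: "\<bar>?d b z\<bar> \<le> norm z * (norm g + 2 * ?r * norm x) + ?r * (norm z)\<^sup>2" if "\<bar>b\<bar> \<le> ?r" for b z
  proof -
    have 1: "\<bar>z \<bullet> g\<bar> \<le> norm z * norm g" by (rule Cauchy_Schwarz_ineq2)
    have "\<bar>b * (z \<bullet> x)\<bar> \<le> ?r * (norm z * norm x)"
      unfolding abs_mult using that by (intro mult_mono Cauchy_Schwarz_ineq2) auto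
    moreover have "\<bar>b * (norm z)\<^sup>2\<bar> \<le> ?r * (norm z)\<^sup>2"
      unfolding abs_mult using that by (intro mult_mono) auto
    moreover have "\<bar>?d b z\<bar> \<le> \<bar>z \<bullet> g\<bar> + 2 * \<bar>b * (z \<bullet> x)\<bar> + \<bar>b * (norm z)\<^sup>2\<bar>" by simp
    ultimately have "\<bar>?d b z\<bar> \<le> norm z * norm g + 2 * (?r * (norm z * norm x)) + ?r * (norm z)\<^sup>2"
      using 1 by linarith
    then show ?thesis by (simp add: algebra_simps)
  qed
  have dw: "\<bar>?d b z * ?w b z\<bar> \<le> ?B z" if "\<bar>b\<bar> \<le> ?r" for b z
    unfolding abs_mult[of "?d b z"] using d[OF that, of z] weight_path_le[OF that, of z x g]
    by (intro mult_mono) auto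
  have "((\<lambda>b. \<integral>z. ?w b z \<partial>\<mu>) has_derivative (\<lambda>h. \<integral>z. ?d a z * ?w a z * h \<partial>\<mu>)) (at a)"
  proof (rule has_derivative_lebesgue_integral[of 1 a \<mu> _ _ ?B])
    show "integrable \<mu> (?w b)" for b by (rule integrable_weight)
    show "((\<lambda>b. ?w b z) has_derivative (\<lambda>h. ?d a z * ?w a z * h)) (at a)" for z
      using has_real_derivative_weight_path[of z x g a] unfolding has_field_derivative_def .
    show "\<bar>?d a z * ?w a z * h\<bar> \<le> ?B z * norm h" for z h
      unfolding abs_mult[of _ h] using dw[of a z] by (intro mult_mono) auto
    show "\<bar>?w b z - ?w a z\<bar> \<le> ?B z * norm (b - a)" if "b \<in> ball a 1" for b z
    proof -
      have "norm (?w b z - ?w a z) \<le> ?B z * norm (b - a)"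
      proof (rule field_differentiable_bound[where S = "ball a 1" and f' = "\<lambda>b. ?d b z * ?w b z"])
        show "((\<lambda>b. ?w b z) has_field_derivative ?d b z * ?w b z) (at b within ball a 1)" for b
          using has_real_derivative_weight_path by (rule has_field_derivative_at_within)
        show "norm (?d b z * ?w b z) \<le> ?B z" if "b \<in> ball a 1" for b
        proof -
          have "\<bar>b\<bar> \<le> ?r" using that by (auto simp: dist_real_def)
          then show ?thesis using dw by simp
        qed
      qed (use that in auto)
      then show ?thesis by simp
    qed
    show "integrable \<mu> ?B"
      using integrable_norm[OF integrable_id] integrable_norm_square by simp
  qed simp_all
  moreover have "(\<integral>z. ?d a z * ?w a z * h \<partial>\<mu>) = output_density a (a *\<^sub>R x + g) * score a x g * h" for h
  proof -
    let ?y = "a *\<^sub>R x + g"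
    have iz: "integrable \<mu> (\<lambda>z. weight a z ?y *\<^sub>R z)" by (intro integrable_weight_scaleR integrable_id)
    have iq: "integrable \<mu> (\<lambda>z. weight a z ?y * (norm z)\<^sup>2)"
      using integrable_weight_scaleR[OF integrable_norm_square] by simp
    have "(\<integral>z. ?d a z * ?w a z \<partial>\<mu>) =
        (\<integral>z. (weight a z ?y *\<^sub>R z) \<bullet> (g + (2 * a) *\<^sub>R x) - a * (weight a z ?y * (norm z)\<^sup>2) \<partial>\<mu>)"
      by (intro Bochner_Integration.integral_cong refl) (simp add: inner_add_right algebra_simps)
    also have "\<dots> = (\<integral>z. weight a z ?y *\<^sub>R z \<partial>\<mu>) \<bullet> (g + (2 * a) *\<^sub>R x) - a * (\<integral>z. weight a z ?y * (norm z)\<^sup>2 \<partial>\<mu>)"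
      using iz iq by (simp del: inner_scaleR_left)
    also have "\<dots> = output_density a ?y * score a x g"
      unfolding integral_weight_scaleR_id integral_weight_norm_square score_def by (simp add: algebra_simps)
    finally show ?thesis by simp
  qed
  ultimately show ?thesis
    unfolding has_field_derivative_def output_density_def[symmetric] by (simp only:)
qed

text \<open>Supplies the continuity in \<open>a\<close> that the fundamental theorem of calculus
  needs; general \<open>k\<close> covers the numerators of both posterior moments.\<close>

lemma isCont_integral_weight_path:
  fixes k :: "real ^ 'n \<Rightarrow> 'c::{banach, second_countable_topology}"
  assumes k: "integrable \<mu> k"
  shows "isCont (\<lambda>a. \<integral>z. weight a z (a *\<^sub>R x + g) *\<^sub>R k z \<partial>\<mu>) a"
proof (rule continuous_at_sequentiallyI)
  fix X :: "nat \<Rightarrow> real" assume X: "X \<longlonglongrightarrow> a"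
  then have "Bseq X" by (intro convergent_imp_Bseq convergentI)
  then obtain r where r: "\<And>n. \<bar>X n\<bar> \<le> r" by (auto simp: Bseq_def)
  show "(\<lambda>n. \<integral>z. weight (X n) z (X n *\<^sub>R x + g) *\<^sub>R k z \<partial>\<mu>) \<longlonglongrightarrow> (\<integral>z. weight a z (a *\<^sub>R x + g) *\<^sub>R k z \<partial>\<mu>)"
  proof (rule integral_dominated_convergence)
    show "integrable \<mu> (\<lambda>z. exp ((r * norm x + norm g)\<^sup>2 / 2) * norm (k z))" using k by simp
    show "AE z in \<mu>. (\<lambda>n. weight (X n) z (X n *\<^sub>R x + g) *\<^sub>R k z) \<longlonglongrightarrow> weight a z (a *\<^sub>R x + g) *\<^sub>R k z"
      unfolding weight_def by (intro AE_I2 tendsto_intros X) simp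
    show "AE z in \<mu>. norm (weight (X n) z (X n *\<^sub>R x + g) *\<^sub>R k z) \<le> exp ((r * norm x + norm g)\<^sup>2 / 2) * norm (k z)" for n
      by (intro AE_I2) (auto intro!: mult_right_mono weight_path_le r)
    show "(\<lambda>z. weight a z (a *\<^sub>R x + g) *\<^sub>R k z) \<in> borel_measurable \<mu>" for a using k by measurable
    then show "(\<lambda>z. weight (X n) z (X n *\<^sub>R x + g) *\<^sub>R k z) \<in> borel_measurable \<mu>" for n .
  qed
qed

lemma isCont_score: "isCont (\<lambda>a. score a x g) a"
proof -
  have h: "isCont (\<lambda>a. output_density a (a *\<^sub>R x + g)) a"
    using has_real_derivative_output_density by (rule DERIV_isCont)
  have [simp]: "output_density a y \<noteq> 0" for y using output_density_pos[of a y] by simp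
  have "isCont (\<lambda>a. posterior_mean a (a *\<^sub>R x + g)) a"
    unfolding posterior_mean_def by (intro continuous_intros isCont_integral_weight_path integrable_id h) simp
  moreover have "isCont (\<lambda>a. posterior_second_moment a (a *\<^sub>R x + g)) a"
    unfolding posterior_second_moment_def
    using isCont_integral_weight_path[OF integrable_norm_square, where x = x and g = g and a = a]
    by (intro continuous_intros h) simp_all
  ultimately show ?thesis
    unfolding score_def by (intro continuous_intros)
qed

text \<open>The lower endpoint contributes nothing: at \<open>a = 0\<close> the output is pure
  noise, so its density relative to the Gaussian is 1.\<close>

lemma integral_score_path:
  "(\<integral>a. score a x g * indicator {0..1} a \<partial>lborel) = ln (output_density 1 (x + g))"
proof -
  have "(\<integral>a. score a x g * indicator {0..1} a \<partial>lborel) =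
      ln (output_density 1 (1 *\<^sub>R x + g)) - ln (output_density 0 (0 *\<^sub>R x + g))"
  proof (rule integral_FTC_Icc_real)
    fix a :: real
    show "((\<lambda>a. ln (output_density a (a *\<^sub>R x + g))) has_real_derivative score a x g) (at a)"
      using output_density_pos[of a "a *\<^sub>R x + g"]
      by (auto intro!: derivative_eq_intros has_real_derivative_output_density)
    show "isCont (\<lambda>a. score a x g) a" by (rule isCont_score)
  qed simp
  then show ?thesis by simp
qed

lemma
  shows integrable_posterior_second_moment: "integrable joint (\<lambda>(x, g). posterior_second_moment a (a *\<^sub>R x + g))"
    and integral_posterior_second_moment:
      "(\<integral>(x, g). posterior_second_moment a (a *\<^sub>R x + g) \<partial>joint) = (\<integral>x. (norm x)\<^sup>2 \<partial>\<mu>)"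
proof -
  have i: "integrable joint (\<lambda>(x, y). weight a x y * (norm x)\<^sup>2)"
    using integrable_joint_fst[OF integrable_norm_square] by (subst integrable_channel[symmetric]) auto
  have "integrable std_gaussian (\<lambda>y. output_density a y * posterior_second_moment a y)"
    using pair.integrable_snd[OF i] by (simp add: integral_weight_norm_square)
  then show j: "integrable joint (\<lambda>(x, g). posterior_second_moment a (a *\<^sub>R x + g))"
    using output_density_pos
    by (intro integrable_outputI) (auto simp: posterior_second_moment_def less_imp_le intro!: divide_nonneg_pos)
  have "(\<integral>(x, g). posterior_second_moment a (a *\<^sub>R x + g) \<partial>joint) = (\<integral>(x, y). weight a x y * (norm x)\<^sup>2 \<partial>joint)"
    using pair.integral_snd[OF i] by (subst integral_output[OF _ j]) (simp_all add: integral_weight_norm_square)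
  also have "\<dots> = (\<integral>(x, g). (norm x)\<^sup>2 \<partial>joint)"
    by (subst integral_channel[symmetric]) auto
  also have "\<dots> = (\<integral>x. (norm x)\<^sup>2 \<partial>\<mu>)" by (intro integral_joint_fst integrable_norm_square)
  finally show "(\<integral>(x, g). posterior_second_moment a (a *\<^sub>R x + g) \<partial>joint) = (\<integral>x. (norm x)\<^sup>2 \<partial>\<mu>)" .
qed

lemma
  shows integrable_inner_channel: "integrable joint (\<lambda>(x, g). x \<bullet> (a *\<^sub>R x + g))"
    and integral_inner_channel: "(\<integral>(x, g). x \<bullet> (a *\<^sub>R x + g) \<partial>joint) = a * (\<integral>x. (norm x)\<^sup>2 \<partial>\<mu>)"
proof -
  note ix = integrable_joint_fst[OF integrable_norm_square]
  note ig = integrable_joint_snd[OF integrable_std_gaussian_norm_square]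
  have i: "integrable joint (\<lambda>(x, g). x \<bullet> g)"
  proof (rule Bochner_Integration.integrable_bound)
    show "integrable joint (\<lambda>z. (case z of (x, g) \<Rightarrow> (norm x)\<^sup>2) + (case z of (x, g) \<Rightarrow> (norm g)\<^sup>2))"
      using ix ig by (rule Bochner_Integration.integrable_add)
    have "\<bar>x \<bullet> g\<bar> \<le> \<bar>(norm x)\<^sup>2 + (norm g)\<^sup>2\<bar>" for x g :: "real ^ 'n"
      using abs_inner_le_squares[of x g] by linarith
    then show "AE z in joint. norm (case z of (x, g) \<Rightarrow> x \<bullet> g) \<le>
        norm ((case z of (x, g) \<Rightarrow> (norm x)\<^sup>2) + (case z of (x, g) \<Rightarrow> (norm g)\<^sup>2))"
      by (intro AE_I2) auto
  qed simp
  \<comment> \<open>Integrating over \<open>x\<close> first makes the cross term vanish because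
    \<mu> is centred.\<close>
  have "(\<integral>(x, g). x \<bullet> g \<partial>joint) = (\<integral>g. \<integral>x. x \<bullet> g \<partial>\<mu> \<partial>std_gaussian)"
    by (rule pair.integral_snd[OF i, symmetric])
  also have "\<dots> = 0"
    using integrable_id by (simp add: integral_id)
  finally have 0: "(\<integral>(x, g). x \<bullet> g \<partial>joint) = 0" .
  have eq: "(\<lambda>(x, g). x \<bullet> (a *\<^sub>R x + g)) =
      (\<lambda>z :: (real ^ 'n) \<times> (real ^ 'n). a * (case z of (x, g) \<Rightarrow> (norm x)\<^sup>2) + (case z of (x, g) \<Rightarrow> x \<bullet> g))"
    by (auto simp: inner_add_right power2_norm_eq_inner)
  show "integrable joint (\<lambda>(x, g). x \<bullet> (a *\<^sub>R x + g))"
    unfolding eq by (intro Bochner_Integration.integrable_add integrable_mult_right ix i)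
  show "(\<integral>(x, g). x \<bullet> (a *\<^sub>R x + g) \<partial>joint) = a * (\<integral>x. (norm x)\<^sup>2 \<partial>\<mu>)"
    unfolding eq using ix i 0 integral_joint_fst[OF integrable_norm_square] by simp
qed

section \<open>Relative entropy of the convolution\<close>

lemma convolution_std_gaussian:
  "\<mu> \<star> std_gaussian = density std_gaussian (\<lambda>y. ennreal (output_density 1 y))"
proof (rule measure_eqI)
  fix A assume "A \<in> sets (\<mu> \<star> std_gaussian)"
  then have [measurable]: "A \<in> sets borel" by simp
  have "emeasure (\<mu> \<star> std_gaussian) A = (\<integral>\<^sup>+(x, g). indicator A (1 *\<^sub>R x + g) \<partial>joint)"
    unfolding convolution_def
    by (simp add: nn_integral_distr case_prod_beta' flip: nn_integral_indicator)
  also have "\<dots> = emeasure (density std_gaussian (\<lambda>y. ennreal (output_density 1 y))) A"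
    by (subst nn_integral_output) (auto simp: emeasure_density)
  finally show "emeasure (\<mu> \<star> std_gaussian) A =
    emeasure (density std_gaussian (\<lambda>y. ennreal (output_density 1 y))) A" .
qed simp

text \<open>The Radon--Nikodym derivative is the output density almost everywhere, and the
  integrability hypothesis selects the finite branch of \<open>relative_entropy\<close>.\<close>

lemma relative_entropy_convolution:
  assumes i: "integrable joint (\<lambda>(x, g). ln (output_density 1 (x + g)))"
  shows "relative_entropy (\<mu> \<star> std_gaussian) std_gaussian =
    ereal (\<integral>(x, g). ln (output_density 1 (x + g)) \<partial>joint)"
proof -
  let ?\<rho> = "\<mu> \<star> std_gaussian" and ?e = "entropy_density (exp 1) std_gaussian (\<mu> \<star> std_gaussian)"
  have ac: "absolutely_continuous std_gaussian ?\<rho>"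
    unfolding convolution_std_gaussian by (rule absolutely_continuousI_density) simp
  have "AE y in std_gaussian. ennreal (output_density 1 y) = RN_deriv std_gaussian ?\<rho> y"
    by (rule gauss.RN_deriv_unique) (simp_all add: convolution_std_gaussian)
  then have "AE y in ?\<rho>. ennreal (output_density 1 y) = RN_deriv std_gaussian ?\<rho> y"
    by (rule absolutely_continuous_AE[OF _ ac, rotated]) simp
  then have ae: "AE y in ?\<rho>. ?e y = ln (output_density 1 y)"
  proof eventually_elim
    case (elim y)
    then show ?case
      using output_density_pos[of 1 y] by (simp add: entropy_density_def log_def flip: elim)
  qed
  have e[measurable]: "?e \<in> borel_measurable ?\<rho>"
    unfolding entropy_density_def by (simp add: comp_def)
  have "integrable ?\<rho> (\<lambda>y. ln (output_density 1 y))"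
    using i unfolding convolution_def by (subst integrable_distr_eq) (auto simp: case_prod_beta')
  then have int: "integrable ?\<rho> ?e"
    using ae by (subst integrable_cong_AE[of _ _ "\<lambda>y. ln (output_density 1 y)"]) auto
  have "KL_divergence (exp 1) std_gaussian ?\<rho> = (\<integral>y. ln (output_density 1 y) \<partial>?\<rho>)"
    unfolding KL_divergence_def using ae by (intro integral_cong_AE) auto
  also have "\<dots> = (\<integral>(x, g). ln (output_density 1 (x + g)) \<partial>joint)"
    unfolding convolution_def by (subst integral_distr) (auto simp: case_prod_beta')
  finally show ?thesis
    unfolding relative_entropy_def using ac int by simp
qed

end

subsection \<open>The Poincare inequality along the channel\<close>

text \<open>The Poincare inequality is kept in the form in which it is applied: the energy is only
  bounded from above, by a real \<open>B\<close>, so all later estimates stay in the reals.\<close>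

locale poincare_channel = gaussian_channel \<mu> for \<mu> :: "(real ^ 'n) measure" +
  fixes C :: real
  assumes C_nonneg: "0 \<le> C"
    and poincare: "\<And>f B. smooth f \<Longrightarrow> square_integrable \<mu> f \<Longrightarrow> 0 \<le> B \<Longrightarrow>
      (\<integral>\<^sup>+x. ennreal ((norm (gradient f x))\<^sup>2) \<partial>\<mu>) \<le> ennreal B \<Longrightarrow> variance_of \<mu> f \<le> C * B"
begin

lemma integral_nth: "(\<integral>x. x $ i \<partial>\<mu>) = 0"
proof -
  have "(\<integral>x. x \<bullet> axis i 1 \<partial>\<mu>) = (\<integral>x. x \<partial>\<mu>) \<bullet> axis i 1"
    by (rule integral_inner_left) (use integrable_id in auto)
  then show ?thesis by (simp add: integral_id inner_axis)
qed

lemma integrable_nth: "integrable \<mu> (\<lambda>x. x $ i)"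
  using integrable_inner_left[of "axis i 1", OF integrable_id] by (simp add: inner_axis)

lemma integrable_nth_square: "integrable \<mu> (\<lambda>x. (x $ i)\<^sup>2)"
proof (rule Bochner_Integration.integrable_bound[OF integrable_norm_square])
  show "AE x in \<mu>. norm ((x $ i)\<^sup>2) \<le> norm ((norm x)\<^sup>2)"
    using component_le_norm_cart by (intro AE_I2) (auto simp: abs_le_square_iff[symmetric])
qed simp

text \<open>The left side is the square of \<open>E[m\<^sub>i \<psi>(Y)] = E[X\<^sub>i \<psi>(Y)] =
  Cov(X\<^sub>i, P(X))\<close>, where \<open>P\<close> is the smoothing of \<open>\<psi>\<close>.
  Square integrability of the posterior mean is not presupposed, as it is what this bound is meant
  to deliver.\<close>

lemma test_function_bound:
  assumes \<psi>: "bounded_support \<psi>"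
  shows "(\<integral>y. output_density a y * (posterior_mean a y $ i * \<psi> y) \<partial>std_gaussian)\<^sup>2 \<le>
    (\<integral>x. (x $ i)\<^sup>2 \<partial>\<mu>) * (C * (a\<^sup>2 * (\<integral>y. output_density a y * (\<psi> y)\<^sup>2 \<partial>std_gaussian)))"
proof -
  have [measurable]: "\<psi> \<in> borel_measurable borel" using \<psi> by (rule bounded_support_measurable)
  obtain K where K: "\<And>y. \<bar>\<psi> y\<bar> \<le> K" using bounded_supportE[OF \<psi>] by blast
  have K2: "\<bar>(\<psi> y)\<^sup>2\<bar> \<le> K\<^sup>2" for y using K[of y] by (metis abs_ge_zero abs_power2 power2_abs power_mono)
  define P where "P = gaussian_smoothing a \<psi>"
  define P2 where "P2 = gaussian_smoothing a (\<lambda>y. (\<psi> y)\<^sup>2)"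
  have [measurable]: "P \<in> borel_measurable borel" "P2 \<in> borel_measurable borel"
    unfolding P_def P2_def gaussian_smoothing_eq_weight by measurable
  have Pb: "\<bar>P x\<bar> \<le> K" for x unfolding P_def by (intro abs_gaussian_smoothing_le K) simp
  have P2b: "\<bar>P2 x\<bar> \<le> K\<^sup>2" for x unfolding P2_def by (intro abs_gaussian_smoothing_le K2) simp
  have P20: "0 \<le> P2 x" for x unfolding P2_def gaussian_smoothing_eq_weight by simp
  have iP: "integrable \<mu> P" using Pb by (intro integrable_const_bound[of _ K]) auto
  have iP2: "integrable \<mu> P2" using P2b by (intro integrable_const_bound[of _ "K\<^sup>2"]) auto
  \<comment> \<open>Taken with \<open>c = 0\<close> for square integrability of \<open>P\<close>,
    and with the mean of \<open>P\<close> for its variance.\<close>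
  have bsq: "integrable \<mu> (\<lambda>x. (P x - c)\<^sup>2)" for c
  proof (rule integrable_const_bound[of _ "(K + \<bar>c\<bar>)\<^sup>2"])
    have "\<bar>P x - c\<bar> \<le> \<bar>K + \<bar>c\<bar>\<bar>" for x using Pb[of x] by linarith
    then show "AE x in \<mu>. norm ((P x - c)\<^sup>2) \<le> (K + \<bar>c\<bar>)\<^sup>2"
      by (simp add: abs_le_square_iff)
  qed simp
  define c where "c = (\<integral>x. P x \<partial>\<mu>)"
  define S where "S = (\<integral>x. P2 x \<partial>\<mu>)"
  have "variance_of \<mu> P \<le> C * (a\<^sup>2 * S)"
  proof (rule poincare)
    show "smooth P" unfolding P_def using \<psi> by (rule smooth_gaussian_smoothing)
    show "square_integrable \<mu> P" using bsq[of 0] by (simp add: square_integrable_def)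
    show "0 \<le> a\<^sup>2 * S" using P20 by (simp add: S_def)
    have "(\<integral>\<^sup>+x. ennreal ((norm (gradient P x))\<^sup>2) \<partial>\<mu>) \<le> (\<integral>\<^sup>+x. ennreal (a\<^sup>2 * P2 x) \<partial>\<mu>)"
      unfolding P_def P2_def
      by (intro nn_integral_mono ennreal_leI norm_gradient_gaussian_smoothing_le \<psi>)
    also have "\<dots> = ennreal (a\<^sup>2 * S)"
      using iP2 P20 by (subst nn_integral_eq_integral) (auto simp: S_def)
    finally show "(\<integral>\<^sup>+x. ennreal ((norm (gradient P x))\<^sup>2) \<partial>\<mu>) \<le> ennreal (a\<^sup>2 * S)" .
  qed
  moreover have "variance_of \<mu> P = (\<integral>x. (P x - c)\<^sup>2 \<partial>\<mu>)" by (simp add: variance_of_def c_def)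
  ultimately have var: "(\<integral>x. (P x - c)\<^sup>2 \<partial>\<mu>) \<le> C * (a\<^sup>2 * S)" by simp
  have ixP: "integrable \<mu> (\<lambda>x. x $ i * P x)"
    using integrable_mult_of_square_integrable[of "\<lambda>x. x $ i" \<mu> P] integrable_nth_square bsq[of 0] by simp
  \<comment> \<open>The coordinate has mean zero, so subtracting \<open>c\<close> is free and turns
    the product into a covariance.\<close>
  have "(\<integral>x. x $ i * (P x - c) \<partial>\<mu>) = (\<integral>x. x $ i * P x - c * x $ i \<partial>\<mu>)"
    by (simp add: algebra_simps)
  also have "\<dots> = (\<integral>x. x $ i * P x \<partial>\<mu>)"
    using ixP integrable_nth integral_nth by simp
  finally have "(\<integral>x. x $ i * P x \<partial>\<mu>)\<^sup>2 = (\<integral>x. x $ i * (P x - c) \<partial>\<mu>)\<^sup>2" by simp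
  also have "\<dots> \<le> (\<integral>x. (x $ i)\<^sup>2 \<partial>\<mu>) * (\<integral>x. (P x - c)\<^sup>2 \<partial>\<mu>)"
    by (intro integral_Cauchy_Schwarz integrable_nth_square bsq) auto
  also have "\<dots> \<le> (\<integral>x. (x $ i)\<^sup>2 \<partial>\<mu>) * (C * (a\<^sup>2 * S))"
    by (intro mult_left_mono var) simp
  finally have main: "(\<integral>x. x $ i * P x \<partial>\<mu>)\<^sup>2 \<le> (\<integral>x. (x $ i)\<^sup>2 \<partial>\<mu>) * (C * (a\<^sup>2 * S))" .
  have i2: "integrable joint (\<lambda>(x, g). (\<psi> (a *\<^sub>R x + g))\<^sup>2)"
    using K2 by (intro pair.integrable_const_bound[of _ "K\<^sup>2"]) auto
  have "S = (\<integral>x. \<integral>g. (\<psi> (a *\<^sub>R x + g))\<^sup>2 \<partial>std_gaussian \<partial>\<mu>)"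
    unfolding S_def P2_def gaussian_smoothing_eq_weight by (simp add: integral_weight_std_gaussian)
  also have "\<dots> = (\<integral>y. output_density a y * (\<psi> y)\<^sup>2 \<partial>std_gaussian)"
    using pair.integral_fst[OF i2] integral_output[OF _ i2] by simp
  finally have S: "S = (\<integral>y. output_density a y * (\<psi> y)\<^sup>2 \<partial>std_gaussian)" .
  have "integrable joint (\<lambda>(x, g). x $ i * \<psi> (a *\<^sub>R x + g))"
  proof (rule Bochner_Integration.integrable_bound)
    show "integrable joint (\<lambda>(x, g). K * x $ i)" by (intro integrable_joint_fst integrable_mult_right integrable_nth)
    have "\<bar>x $ i\<bar> * \<bar>\<psi> y\<bar> \<le> \<bar>K\<bar> * \<bar>x $ i\<bar>" for x y
      using K[of y] by (subst mult.commute) (intro mult_right_mono, auto)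
    then show "AE z in joint. norm (case z of (x, g) \<Rightarrow> x $ i * \<psi> (a *\<^sub>R x + g)) \<le> norm (case z of (x, g) \<Rightarrow> K * x $ i)"
      by (intro AE_I2) (auto simp: abs_mult)
  qed simp
  then have i1: "integrable joint (\<lambda>(x, y). weight a x y * (x $ i * \<psi> y))"
    by (subst (asm) integrable_channel) auto
  have inner: "(\<integral>x. weight a x y * (x $ i * \<psi> y) \<partial>\<mu>) = output_density a y * (posterior_mean a y $ i * \<psi> y)" for y
  proof -
    have "(\<integral>x. (weight a x y *\<^sub>R x) \<bullet> axis i 1 \<partial>\<mu>) = (\<integral>x. weight a x y *\<^sub>R x \<partial>\<mu>) \<bullet> axis i 1"
      by (rule integral_inner_left) (use integrable_weight_scaleR[OF integrable_id] in auto)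
    then have "(\<integral>x. weight a x y * x $ i \<partial>\<mu>) = output_density a y * posterior_mean a y $ i"
      by (simp add: inner_axis integral_weight_scaleR_id)
    moreover have "(\<integral>x. weight a x y * (x $ i * \<psi> y) \<partial>\<mu>) = (\<integral>x. weight a x y * x $ i \<partial>\<mu>) * \<psi> y"
      by (simp flip: integral_mult_left_zero add: mult.assoc)
    ultimately show ?thesis by simp
  qed
  \<comment> \<open>Integrating over \<open>y\<close> first produces the smoothing, over
    \<open>x\<close> first the posterior mean; equality of the two orders is the duality.\<close>
  have "(\<integral>x. x $ i * P x \<partial>\<mu>) = (\<integral>x. \<integral>y. weight a x y * (x $ i * \<psi> y) \<partial>std_gaussian \<partial>\<mu>)"
    unfolding P_def gaussian_smoothing_eq_weight integral_mult_right_zero[symmetric] by (simp add: mult_ac)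
  also have "\<dots> = (\<integral>y. \<integral>x. weight a x y * (x $ i * \<psi> y) \<partial>\<mu> \<partial>std_gaussian)"
    using pair.Fubini_integral[OF i1] by simp
  also have "\<dots> = (\<integral>y. output_density a y * (posterior_mean a y $ i * \<psi> y) \<partial>std_gaussian)"
    by (simp only: inner)
  finally show ?thesis using main S by simp
qed

lemma
  shows integrable_posterior_mean_nth_square:
      "integrable std_gaussian (\<lambda>y. output_density a y * (posterior_mean a y $ i)\<^sup>2)"
    and integral_posterior_mean_nth_square_le:
      "(\<integral>y. output_density a y * (posterior_mean a y $ i)\<^sup>2 \<partial>std_gaussian) \<le> C * a\<^sup>2 * (\<integral>x. (x $ i)\<^sup>2 \<partial>\<mu>)"
proof -
  define L where "L = C * a\<^sup>2 * (\<integral>x. (x $ i)\<^sup>2 \<partial>\<mu>)"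
  have L0: "0 \<le> L" using C_nonneg by (simp add: L_def)
  define T where "T n = {y. \<bar>posterior_mean a y $ i\<bar> \<le> real n \<and> norm y \<le> real n}" for n
  have [measurable]: "T n \<in> sets borel" for n unfolding T_def by measurable
  \<comment> \<open>The duality would use \<open>\<psi> = m\<^sub>i\<close>, which is truncated to make its smoothing admissible in the
    Poincare inequality; \<open>m\<^sub>i \<psi> = \<psi>\<^sup>2\<close> survives the truncation.\<close>
  define \<psi> where "\<psi> n y = indicator (T n) y * posterior_mean a y $ i" for n y
  let ?f = "\<lambda>n y. output_density a y * (\<psi> n y)\<^sup>2"
  let ?u = "\<lambda>y. output_density a y * (posterior_mean a y $ i)\<^sup>2"
  have [measurable]: "\<psi> n \<in> borel_measurable borel" for n unfolding \<psi>_def by measurable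
  have bs: "bounded_support (\<psi> n)" for n
    unfolding bounded_support_def
    by (intro conjI exI[of _ "real n"]) (auto simp: \<psi>_def T_def indicator_def)
  have h: "0 \<le> output_density a y" for y using output_density_pos[of a y] by simp
  have intf: "integrable std_gaussian (?f n)" for n
  proof (rule integrable_output)
    have "(\<psi> n y)\<^sup>2 \<le> (real n)\<^sup>2" for y
      by (auto simp: \<psi>_def T_def indicator_def simp flip: abs_le_square_iff)
    then show "integrable joint (\<lambda>(x, g). (\<psi> n (a *\<^sub>R x + g))\<^sup>2)"
      by (intro pair.integrable_const_bound[of _ "(real n)\<^sup>2"]) auto
  qed simp
  have le: "(\<integral>y. ?f n y \<partial>std_gaussian) \<le> L" for n
  proof -
    let ?A = "\<integral>y. ?f n y \<partial>std_gaussian"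
    have "posterior_mean a y $ i * \<psi> n y = (\<psi> n y)\<^sup>2" for y
      by (simp add: \<psi>_def power2_eq_square indicator_def)
    with test_function_bound[OF bs, of a i n]
    have "?A\<^sup>2 \<le> (\<integral>x. (x $ i)\<^sup>2 \<partial>\<mu>) * (C * (a\<^sup>2 * ?A))" by simp
    \<comment> \<open>The test-function bound is quadratic in \<open>?A\<close> on the left and
      linear on the right, so one factor cancels and a bound independent of \<open>n\<close>
      remains.\<close>
    then have "?A * ?A \<le> L * ?A"
      unfolding power2_eq_square[of ?A] L_def by (simp only: mult_ac)
    moreover have "0 \<le> ?A" using h by simp
    ultimately show ?thesis using L0 by (cases "?A = 0") (auto intro: mult_right_le_imp_le)
  qed
  \<comment> \<open>The sets \<open>T n\<close> increase to the whole space, so monotone convergence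
    yields integrability and the bound together.\<close>
  have "(\<lambda>n. \<integral>\<^sup>+y. ennreal (?f n y) \<partial>std_gaussian) \<longlonglongrightarrow> (\<integral>\<^sup>+y. ennreal (?u y) \<partial>std_gaussian)"
  proof (rule nn_integral_LIMSEQ)
    show "incseq (\<lambda>n y. ennreal (?f n y))"
      unfolding incseq_def le_fun_def
      by (auto intro!: ennreal_leI mult_left_mono h simp: \<psi>_def T_def indicator_def)
    show "(\<lambda>n. ennreal (?f n y)) \<longlonglongrightarrow> ennreal (?u y)" for y
    proof (rule tendsto_eventually)
      obtain N where N: "\<bar>posterior_mean a y $ i\<bar> + norm y \<le> real N" using real_arch_simple by blast
      show "\<forall>\<^sub>F n in sequentially. ennreal (?f n y) = ennreal (?u y)"
      proof (rule eventually_sequentiallyI[of N])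
        fix n assume "N \<le> n"
        then have "\<bar>posterior_mean a y $ i\<bar> + norm y \<le> real n" using N by linarith
        then have "y \<in> T n" by (auto simp: T_def intro: order_trans[of _ "\<bar>posterior_mean a y $ i\<bar> + norm y"])
        then show "ennreal (?f n y) = ennreal (?u y)" by (simp add: \<psi>_def)
      qed
    qed
  qed simp
  moreover have "(\<integral>\<^sup>+y. ennreal (?f n y) \<partial>std_gaussian) \<le> ennreal L" for n
    using le[of n] h by (subst nn_integral_eq_integral[OF intf]) (auto intro: ennreal_leI)
  ultimately have nn: "(\<integral>\<^sup>+y. ennreal (?u y) \<partial>std_gaussian) \<le> ennreal L"
    by (intro LIMSEQ_le_const2) auto
  show i: "integrable std_gaussian ?u"
    by (rule integrableI_nonneg) (use h in \<open>auto simp: le_less_trans[OF nn]\<close>)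
  have "ennreal (integral\<^sup>L std_gaussian ?u) \<le> ennreal L"
    using nn h by (subst (asm) nn_integral_eq_integral[OF i]) auto
  then show "integral\<^sup>L std_gaussian ?u \<le> C * a\<^sup>2 * (\<integral>x. (x $ i)\<^sup>2 \<partial>\<mu>)"
    using L0 by (simp add: L_def)
qed

lemma
  shows integrable_posterior_mean_square:
      "integrable std_gaussian (\<lambda>y. output_density a y * (norm (posterior_mean a y))\<^sup>2)"
    and integral_posterior_mean_square_le:
      "(\<integral>y. output_density a y * (norm (posterior_mean a y))\<^sup>2 \<partial>std_gaussian) \<le> C * a\<^sup>2 * (\<integral>x. (norm x)\<^sup>2 \<partial>\<mu>)"
proof -
  have n: "(norm z)\<^sup>2 = (\<Sum>i\<in>UNIV. (z $ i)\<^sup>2)" for z :: "real ^ 'n"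
    unfolding power2_norm_eq_inner inner_vec_def by (simp add: power2_eq_square)
  show "integrable std_gaussian (\<lambda>y. output_density a y * (norm (posterior_mean a y))\<^sup>2)"
    unfolding n sum_distrib_left by (intro Bochner_Integration.integrable_sum integrable_posterior_mean_nth_square)
  have "(\<integral>y. output_density a y * (norm (posterior_mean a y))\<^sup>2 \<partial>std_gaussian) =
      (\<Sum>i\<in>UNIV. \<integral>y. output_density a y * (posterior_mean a y $ i)\<^sup>2 \<partial>std_gaussian)"
    unfolding n sum_distrib_left by (intro Bochner_Integration.integral_sum integrable_posterior_mean_nth_square)
  also have "\<dots> \<le> (\<Sum>i\<in>UNIV. C * a\<^sup>2 * (\<integral>x. (x $ i)\<^sup>2 \<partial>\<mu>))"
    by (intro sum_mono integral_posterior_mean_nth_square_le)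
  also have "\<dots> = C * a\<^sup>2 * (\<integral>x. (norm x)\<^sup>2 \<partial>\<mu>)"
    unfolding n by (subst Bochner_Integration.integral_sum) (auto intro: integrable_nth_square simp: sum_distrib_left)
  finally show "(\<integral>y. output_density a y * (norm (posterior_mean a y))\<^sup>2 \<partial>std_gaussian) \<le> C * a\<^sup>2 * (\<integral>x. (norm x)\<^sup>2 \<partial>\<mu>)" .
qed

section \<open>The I-MMSE identity and its integration\<close>

definition posterior_energy :: "real \<Rightarrow> real" where
  "posterior_energy a = (\<integral>y. output_density a y * (norm (posterior_mean a y))\<^sup>2 \<partial>std_gaussian)"

lemma
  shows integrable_posterior_mean_channel: "integrable joint (\<lambda>(x, g). (norm (posterior_mean a (a *\<^sub>R x + g)))\<^sup>2)"
    and integral_posterior_mean_channel: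
      "(\<integral>(x, g). (norm (posterior_mean a (a *\<^sub>R x + g)))\<^sup>2 \<partial>joint) = posterior_energy a"
proof -
  show i: "integrable joint (\<lambda>(x, g). (norm (posterior_mean a (a *\<^sub>R x + g)))\<^sup>2)"
    by (intro integrable_outputI integrable_posterior_mean_square) auto
  show "(\<integral>(x, g). (norm (posterior_mean a (a *\<^sub>R x + g)))\<^sup>2 \<partial>joint) = posterior_energy a"
    unfolding posterior_energy_def by (intro integral_output i) auto
qed

text \<open>Write \<open>g + 2 a x = Y + a x\<close> in the score. Conditioning gives
  \<open>E(m \<bullet> Y) = E(X \<bullet> Y) = a E|X|^2\<close>, which cancels exactly against
  \<open>a\<close> times the mean posterior second moment, while
  \<open>a E(m \<bullet> X) = a E|m|^2\<close> survives. The bound on the absolute value is there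
  for Fubini in \<open>a\<close>.\<close>

lemma
  shows integrable_score: "integrable joint (\<lambda>(x, g). score a x g)"
    and integral_score: "(\<integral>(x, g). score a x g \<partial>joint) = a * posterior_energy a"
    and integral_abs_score_le: "\<bar>a\<bar> \<le> 1 \<Longrightarrow> (\<integral>(x, g). \<bar>score a x g\<bar> \<partial>joint) \<le>
      2 * posterior_energy a + (\<integral>g. (norm (g :: real ^ 'n))\<^sup>2 \<partial>std_gaussian) + 2 * (\<integral>x. (norm x)\<^sup>2 \<partial>\<mu>)"
proof -
  let ?Y = "\<lambda>x g. a *\<^sub>R x + g" and ?m = "posterior_mean a" and ?q = "posterior_second_moment a"
  let ?M = "\<lambda>(x, g). (norm (?m (?Y x g)))\<^sup>2" and ?X2 = "\<lambda>(x, g). (norm x)\<^sup>2" and ?G2 = "\<lambda>(x, g). (norm g)\<^sup>2"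
    and ?Q = "\<lambda>(x, g). ?q (?Y x g)"
  note iM = integrable_posterior_mean_channel[of a]
  note iX = integrable_joint_fst[OF integrable_norm_square]
  note iG = integrable_joint_snd[OF integrable_std_gaussian_norm_square]
  note iQ = integrable_posterior_second_moment[of a]
  have imx: "integrable joint (\<lambda>(x, g). ?m (?Y x g) \<bullet> x)"
  proof (rule Bochner_Integration.integrable_bound)
    show "integrable joint (\<lambda>z. ?M z + ?X2 z)"
      using iM iX by (rule Bochner_Integration.integrable_add)
    have "\<bar>u \<bullet> v\<bar> \<le> \<bar>(norm u)\<^sup>2 + (norm v)\<^sup>2\<bar>" for u v :: "real ^ 'n"
      using abs_inner_le_squares[of u v] by linarith
    then show "AE z in joint. norm (case z of (x, g) \<Rightarrow> ?m (?Y x g) \<bullet> x) \<le> norm (?M z + ?X2 z)"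
      by (intro AE_I2) auto
  qed simp
  have img: "integrable joint (\<lambda>(x, g). ?m (?Y x g) \<bullet> g)"
  proof (rule Bochner_Integration.integrable_bound)
    show "integrable joint (\<lambda>z. ?M z + ?G2 z)"
      using iM iG by (rule Bochner_Integration.integrable_add)
    have "\<bar>u \<bullet> v\<bar> \<le> \<bar>(norm u)\<^sup>2 + (norm v)\<^sup>2\<bar>" for u v :: "real ^ 'n"
      using abs_inner_le_squares[of u v] by linarith
    then show "AE z in joint. norm (case z of (x, g) \<Rightarrow> ?m (?Y x g) \<bullet> g) \<le> norm (?M z + ?G2 z)"
      by (intro AE_I2) auto
  qed simp
  have imY: "integrable joint (\<lambda>(x, g). ?m (?Y x g) \<bullet> ?Y x g)"
  proof -
    have "integrable joint (\<lambda>z. a * (case z of (x, g) \<Rightarrow> ?m (?Y x g) \<bullet> x) + (case z of (x, g) \<Rightarrow> ?m (?Y x g) \<bullet> g))"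
      by (intro Bochner_Integration.integrable_add integrable_mult_right imx img)
    then show ?thesis by (simp add: case_prod_beta' inner_add_right)
  qed
  have inner: "(\<integral>x. weight a x y * (v \<bullet> x) \<partial>\<mu>) = output_density a y * (v \<bullet> ?m y)" for y v
  proof -
    have "(\<integral>x. v \<bullet> (weight a x y *\<^sub>R x) \<partial>\<mu>) = v \<bullet> (\<integral>x. weight a x y *\<^sub>R x \<partial>\<mu>)"
      by (rule integral_inner_right) (use integrable_weight_scaleR[OF integrable_id] in auto)
    then show ?thesis by (simp add: integral_weight_scaleR_id)
  qed
  have vmx: "(\<integral>(x, g). ?m (?Y x g) \<bullet> x \<partial>joint) = posterior_energy a"
  proof -
    have i: "integrable joint (\<lambda>(x, y). weight a x y * (?m y \<bullet> x))"
      using imx by (subst (asm) integrable_channel) auto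
    have "(\<integral>(x, g). ?m (?Y x g) \<bullet> x \<partial>joint) = (\<integral>(x, y). weight a x y * (?m y \<bullet> x) \<partial>joint)"
      by (rule integral_channel) simp
    also have "\<dots> = (\<integral>y. \<integral>x. weight a x y * (?m y \<bullet> x) \<partial>\<mu> \<partial>std_gaussian)"
      by (rule pair.integral_snd[OF i, symmetric])
    finally show ?thesis by (simp add: inner posterior_energy_def power2_norm_eq_inner)
  qed
  have vmY: "(\<integral>(x, g). ?m (?Y x g) \<bullet> ?Y x g \<partial>joint) = a * (\<integral>x. (norm x)\<^sup>2 \<partial>\<mu>)"
  proof -
    have i: "integrable joint (\<lambda>(x, y). weight a x y * (x \<bullet> y))"
      using integrable_inner_channel[of a] by (subst (asm) integrable_channel) auto
    have "(\<integral>(x, g). ?m (?Y x g) \<bullet> ?Y x g \<partial>joint) = (\<integral>y. output_density a y * (?m y \<bullet> y) \<partial>std_gaussian)"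
      using imY by (intro integral_output) auto
    also have "\<dots> = (\<integral>y. \<integral>x. weight a x y * (x \<bullet> y) \<partial>\<mu> \<partial>std_gaussian)"
      using inner by (intro Bochner_Integration.integral_cong refl) (simp add: inner_commute)
    also have "\<dots> = (\<integral>(x, y). weight a x y * (x \<bullet> y) \<partial>joint)"
      by (rule pair.integral_snd[OF i])
    also have "\<dots> = (\<integral>(x, g). x \<bullet> ?Y x g \<partial>joint)"
      by (rule integral_channel[symmetric]) simp
    finally show ?thesis by (simp add: integral_inner_channel)
  qed
  have eq: "(\<lambda>(x, g). score a x g) = (\<lambda>z. (case z of (x, g) \<Rightarrow> ?m (?Y x g) \<bullet> ?Y x g) +
      a * (case z of (x, g) \<Rightarrow> ?m (?Y x g) \<bullet> x) - a * ?Q z)"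
    by (auto simp: score_def inner_add_right algebra_simps)
  show iS: "integrable joint (\<lambda>(x, g). score a x g)"
    unfolding eq
    by (intro Bochner_Integration.integrable_add Bochner_Integration.integrable_diff integrable_mult_right imx imY iQ)
  have "(\<integral>z. (case z of (x, g) \<Rightarrow> ?m (?Y x g) \<bullet> ?Y x g) +
      a * (case z of (x, g) \<Rightarrow> ?m (?Y x g) \<bullet> x) - a * ?Q z \<partial>joint) =
      a * (\<integral>x. (norm x)\<^sup>2 \<partial>\<mu>) + a * posterior_energy a - a * (\<integral>x. (norm x)\<^sup>2 \<partial>\<mu>)"
    using imx imY iQ by (simp add: vmx vmY integral_posterior_second_moment)
  then show "(\<integral>(x, g). score a x g \<partial>joint) = a * posterior_energy a"
    unfolding eq by simp
  assume a: "\<bar>a\<bar> \<le> 1"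
  have q0: "0 \<le> ?q y" for y
    using output_density_pos[of a y] by (simp add: posterior_second_moment_def)
  have "\<bar>score a x g\<bar> \<le> 2 * (norm (?m (?Y x g)))\<^sup>2 + (norm g)\<^sup>2 + (norm x)\<^sup>2 + ?q (?Y x g)" for x g
  proof -
    let ?v = "?m (?Y x g)"
    have "\<bar>score a x g\<bar> \<le> \<bar>?v \<bullet> g\<bar> + \<bar>a\<bar> * (2 * \<bar>?v \<bullet> x\<bar>) + \<bar>a\<bar> * ?q (?Y x g)"
      using q0[of "?Y x g"] unfolding score_def inner_add_right inner_scaleR_right
      by (auto simp: abs_mult intro!: order_trans[OF abs_triangle_ineq4] order_trans[OF abs_triangle_ineq])
    moreover have "\<bar>a\<bar> * (2 * \<bar>?v \<bullet> x\<bar>) \<le> 1 * (2 * \<bar>?v \<bullet> x\<bar>)" by (intro mult_right_mono a) simp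
    moreover have "\<bar>a\<bar> * ?q (?Y x g) \<le> 1 * ?q (?Y x g)" by (intro mult_right_mono a q0)
    ultimately show ?thesis
      using abs_inner_le_squares[of ?v g] abs_inner_le_squares[of ?v x]
        zero_le_power2[of "norm ?v"] zero_le_power2[of "norm g"] by linarith
  qed
  then have "(\<integral>(x, g). \<bar>score a x g\<bar> \<partial>joint) \<le> (\<integral>z. 2 * ?M z + ?G2 z + ?X2 z + ?Q z \<partial>joint)"
    using iS iM iG iX iQ
    by (intro Bochner_Integration.integral_mono) (auto simp: case_prod_beta')
  also have "\<dots> = 2 * posterior_energy a + (\<integral>g. (norm (g :: real ^ 'n))\<^sup>2 \<partial>std_gaussian) + 2 * (\<integral>x. (norm x)\<^sup>2 \<partial>\<mu>)"
    using iM iG iX iQ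
    by (simp add: integral_posterior_mean_channel integral_posterior_second_moment
        integral_joint_fst[OF integrable_norm_square] integral_joint_snd[OF integrable_std_gaussian_norm_square])
  finally show "(\<integral>(x, g). \<bar>score a x g\<bar> \<partial>joint) \<le>
      2 * posterior_energy a + (\<integral>g. (norm (g :: real ^ 'n))\<^sup>2 \<partial>std_gaussian) + 2 * (\<integral>x. (norm x)\<^sup>2 \<partial>\<mu>)" .
qed

text \<open>Fubini exchanges the path integral with the expectation. Integrability of the
  log-density, and hence finiteness of the entropy, is a by-product: it is a partial integral of a
  function integrable on the product.\<close>

lemma
  shows integrable_ln_output_density: "integrable joint (\<lambda>(x, g). ln (output_density 1 (x + g)))"
    and integral_ln_output_density_le:
      "(\<integral>(x, g). ln (output_density 1 (x + g)) \<partial>joint) \<le> C * (\<integral>x. (norm x)\<^sup>2 \<partial>\<mu>) / 4"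
proof -
  interpret path: pair_sigma_finite lborel joint ..
  define T where "T = (\<integral>x. (norm x)\<^sup>2 \<partial>\<mu>)"
  have T0: "0 \<le> T" by (simp add: T_def)
  have energy: "posterior_energy a \<le> C * a\<^sup>2 * T" for a
    unfolding posterior_energy_def T_def by (rule integral_posterior_mean_square_le)
  \<comment> \<open>A bound for the mean absolute score that is uniform over the unit interval,
    where the posterior energy is at most \<open>C * T\<close>.\<close>
  define K where "K = 2 * (C * T) + (\<integral>g. (norm (g :: real ^ 'n))\<^sup>2 \<partial>std_gaussian) + 2 * T"
  let ?f = "\<lambda>(a, x, g). score a x g * indicator {0..1} a"
  have bnd: "(\<integral>(x, g). \<bar>score a x g\<bar> \<partial>joint) \<le> K" if "a \<in> {0..1}" for a
  proof -
    have "a\<^sup>2 \<le> 1" using that by (auto intro: power_le_one)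
    then have "C * T * a\<^sup>2 \<le> C * T * 1" by (intro mult_left_mono) (auto simp: C_nonneg T0)
    then have "posterior_energy a \<le> C * T"
      using energy[of a] by (simp add: mult_ac)
    then show ?thesis
      using integral_abs_score_le[of a] that unfolding K_def T_def by simp
  qed
  have meas: "?f \<in> borel_measurable (lborel \<Otimes>\<^sub>M joint)" by measurable
  have i: "integrable (lborel \<Otimes>\<^sub>M joint) ?f"
  proof (rule path.Fubini_integrable[OF meas])
    show "integrable lborel (\<lambda>a. \<integral>z. norm (?f (a, z)) \<partial>joint)"
    proof (rule Bochner_Integration.integrable_bound)
      show "integrable lborel (\<lambda>a::real. K * indicator {0..1} a)"
        by (intro integrable_mult_right integrable_real_indicator) auto
      show "(\<lambda>a. \<integral>z. norm (?f (a, z)) \<partial>joint) \<in> borel_measurable lborel"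
        using meas by measurable
      show "AE a in lborel. norm (\<integral>z. norm (?f (a, z)) \<partial>joint) \<le> norm (K * indicator {0..1} a)"
      proof (rule AE_I2)
        fix a :: real
        have "\<bar>\<integral>(x, g). \<bar>score a x g\<bar> \<partial>joint\<bar> \<le> \<bar>K\<bar>" if "a \<in> {0..1}"
          using bnd[OF that] by (subst abs_of_nonneg) (auto simp: case_prod_beta')
        then show "norm (\<integral>z. norm (?f (a, z)) \<partial>joint) \<le> norm (K * indicator {0..1} a)"
          by (cases "a \<in> {0..1}") (auto simp: case_prod_beta' abs_mult)
      qed
    qed
    show "AE a in lborel. integrable joint (\<lambda>z. ?f (a, z))"
    proof (rule AE_I2)
      fix a :: real
      show "integrable joint (\<lambda>z. ?f (a, z))"
        using integrable_mult_left[OF integrable_score[of a], of "indicator {0..1} a"]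
        by (simp add: case_prod_beta')
    qed
  qed
  have inner: "(\<integral>a. ?f (a, z) \<partial>lborel) = (case z of (x, g) \<Rightarrow> ln (output_density 1 (x + g)))" for z
    by (cases z) (simp add: integral_score_path)
  have i': "integrable (lborel \<Otimes>\<^sub>M joint) (\<lambda>(a, z). ?f (a, z))" using i by simp
  show "integrable joint (\<lambda>(x, g). ln (output_density 1 (x + g)))"
    using path.integrable_snd[OF i'] unfolding inner .
  have "(\<integral>(x, g). ln (output_density 1 (x + g)) \<partial>joint) = (\<integral>z. \<integral>a. ?f (a, z) \<partial>lborel \<partial>joint)"
    unfolding inner ..
  also have "\<dots> = (\<integral>a. \<integral>z. ?f (a, z) \<partial>joint \<partial>lborel)"
    by (rule path.Fubini_integral[OF i'])
  also have "\<dots> \<le> (\<integral>a. (C * T * a ^ 3) * indicator {0..1} a \<partial>lborel)"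
  proof (rule Bochner_Integration.integral_mono)
    show "integrable lborel (\<lambda>a. \<integral>z. ?f (a, z) \<partial>joint)" by (rule path.integrable_fst[OF i'])
    show "integrable lborel (\<lambda>a. C * T * a ^ 3 * indicator {0..1} a)"
      by (intro borel_integrable_atLeastAtMost continuous_intros)
    fix a :: real
    have "(\<integral>z. ?f (a, z) \<partial>joint) = a * posterior_energy a * indicator {0..1} a"
      using integral_score[of a] by (simp add: case_prod_beta')
    also have "\<dots> \<le> C * T * a ^ 3 * indicator {0..1} a"
      using mult_left_mono[OF energy[of a], of a]
      by (auto simp: indicator_def power2_eq_square power3_eq_cube mult_ac)
    finally show "(\<integral>z. ?f (a, z) \<partial>joint) \<le> C * T * a ^ 3 * indicator {0..1} a" .
  qed
  \<comment> \<open>The integrand is the factor \<open>a\<close> of the entropy identity times the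
    energy bound \<open>C * a^2 * T\<close>; integrating the cube is the origin of 1/4.\<close>
  also have "\<dots> = C * T * 1 ^ 4 / 4 - C * T * 0 ^ 4 / 4"
    by (rule integral_FTC_Icc_real[where F = "\<lambda>a. C * T * a ^ 4 / 4"])
      (auto intro!: derivative_eq_intros continuous_intros)
  finally show "(\<integral>(x, g). ln (output_density 1 (x + g)) \<partial>joint) \<le> C * (\<integral>x. (norm x)\<^sup>2 \<partial>\<mu>) / 4"
    by (simp add: T_def)
qed

end

section \<open>From the Poincare constant to the channel, and conclusion\<close>

text \<open>Shows that the infimum itself is admissible: for \<open>B > 0\<close> the quotient of
  variance by \<open>B\<close> is a lower bound for all admissible constants, hence for their
  infimum.\<close>

lemma variance_le_poincare_constant:
  assumes fin: "poincare_constant \<mu> < \<infinity>"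
    and f: "smooth f" "square_integrable \<mu> f" and "0 \<le> B"
    and le: "(\<integral>\<^sup>+x. ennreal ((norm (gradient f x))\<^sup>2) \<partial>\<mu>) \<le> ennreal B"
  shows "variance_of \<mu> f \<le> enn2real (poincare_constant \<mu>) * B"
proof -
  let ?S = "{C. \<forall>f. smooth f \<and> square_integrable \<mu> f \<longrightarrow>
       ennreal (variance_of \<mu> f) \<le> C * (\<integral>\<^sup>+x. ennreal ((norm (gradient f x))\<^sup>2) \<partial>\<mu>)}"
  have v0: "0 \<le> variance_of \<mu> f" by (simp add: variance_of_def)
  have *: "ennreal (variance_of \<mu> f) \<le> C * ennreal B" if "C \<in> ?S" for C
  proof -
    have "ennreal (variance_of \<mu> f) \<le> C * (\<integral>\<^sup>+x. ennreal ((norm (gradient f x))\<^sup>2) \<partial>\<mu>)"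
      using that f by blast
    also have "\<dots> \<le> C * ennreal B" using le by (rule mult_left_mono) simp
    finally show ?thesis .
  qed
  obtain C0 where C0: "C0 \<in> ?S"
    using fin unfolding poincare_constant_def Inf_less_iff by blast
  obtain r where r: "0 \<le> r" "poincare_constant \<mu> = ennreal r"
    using fin by (cases "poincare_constant \<mu>") auto
  show ?thesis
  proof (cases "B = 0")
    \<comment> \<open>Division by \<open>B\<close> is impossible here, but any admissible constant
      forces the variance to vanish, because multiplying by 0 gives 0 in
      \<open>ennreal\<close>.\<close>
    case True
    then show ?thesis using *[OF C0] v0 by (simp add: ennreal_eq_0_iff)
  next
    case False
    with \<open>0 \<le> B\<close> have B: "0 < B" by simp
    have "ennreal (variance_of \<mu> f / B) \<le> Inf ?S"
    proof (rule Inf_greatest)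
      fix C assume "C \<in> ?S"
      note * = *[OF this]
      show "ennreal (variance_of \<mu> f / B) \<le> C"
      proof (cases C)
        case (real c)
        then have "variance_of \<mu> f \<le> c * B" using * B by (simp flip: ennreal_mult')
        then show ?thesis using real B by (simp add: ennreal_leI divide_simps)
      qed simp
    qed
    then have "variance_of \<mu> f / B \<le> r"
      using r v0 B unfolding poincare_constant_def[symmetric] by simp
    then show ?thesis using r B by (simp add: divide_simps)
  qed
qed

lemma trace_covariance_matrix_centred:
  fixes \<mu> :: "(real ^ 'n) measure"
  assumes "centred \<mu>" and "finite_covariance \<mu>"
  shows "integrable \<mu> (\<lambda>x. (norm x)\<^sup>2)" "trace (covariance_matrix \<mu>) = (\<integral>x. (norm x)\<^sup>2 \<partial>\<mu>)"
proof -
  have m: "mean \<mu> = 0" using assms(1) by (simp add: mean_def centred_def)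
  have i: "integrable \<mu> (\<lambda>x. x $ i * x $ i)" for i
    using assms(2) by (simp add: finite_covariance_def m)
  have n: "(norm x)\<^sup>2 = (\<Sum>i\<in>UNIV. x $ i * x $ i)" for x :: "real ^ 'n"
    unfolding power2_norm_eq_inner inner_vec_def by simp
  show "integrable \<mu> (\<lambda>x. (norm x)\<^sup>2)" unfolding n by (intro Bochner_Integration.integrable_sum i)
  show "trace (covariance_matrix \<mu>) = (\<integral>x. (norm x)\<^sup>2 \<partial>\<mu>)"
    unfolding n using i by (simp add: trace_def covariance_matrix_def m)
qed

theorem theorem2p8:
  fixes \<mu> :: "(real ^ 'n) measure"
  assumes "prob_space \<mu>" and "sets \<mu> = sets borel"
    and "centred \<mu>"
    and "absolutely_continuous lborel \<mu>"
    and "finite_covariance \<mu>"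
    and "poincare_constant \<mu> < \<infinity>"
  shows "relative_entropy (\<mu> \<star> std_gaussian) std_gaussian
      \<le> ereal (ln 2 / 2 * enn2real (poincare_constant \<mu>) * trace (covariance_matrix \<mu>))"
proof -
  let ?C = "enn2real (poincare_constant \<mu>)"
  interpret prob_space \<mu> by fact
  interpret poincare_channel \<mu> ?C
  proof unfold_locales
    show "sets \<mu> = sets borel" by fact
    show "integrable \<mu> (\<lambda>x. (norm x)\<^sup>2)" by (rule trace_covariance_matrix_centred) fact+
    show "(\<integral>x. x \<partial>\<mu>) = 0" using assms(3) by (simp add: centred_def)
  qed (use variance_le_poincare_constant[OF assms(6)] in auto)
  \<comment> \<open>Even the crude bound \<open>2 / 3 \<le> ln 2\<close> leaves room, as it gives
    1/3 on the right.\<close>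
  have "1 / 4 \<le> ln 2 / (2 :: real)" using ln2_ge_two_thirds by simp
  then have "1 / 4 * (?C * trace (covariance_matrix \<mu>)) \<le> ln 2 / 2 * (?C * trace (covariance_matrix \<mu>))"
    using assms by (intro mult_right_mono mult_nonneg_nonneg) (auto simp: trace_covariance_matrix_centred)
  moreover have "(\<integral>(x, g). ln (output_density 1 (x + g)) \<partial>joint) \<le> ?C * trace (covariance_matrix \<mu>) / 4"
    using integral_ln_output_density_le assms by (simp add: trace_covariance_matrix_centred)
  ultimately show ?thesis
    unfolding relative_entropy_convolution[OF integrable_ln_output_density] ereal_less_eq(3) mult.assoc by argo
qed

end
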